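(* Suppose $\beta:=\max\{\mathrm{Tr}(X):\ X\in\mathbb{S}^n,\ \mathcal{A}(X)=b,\ Xe=0,\ X\succeq0\}<\infty$ and $r\ge\left\lceil\frac\beta\alpha\right\rceil+\sqrt{2m}$. Then for all $C\in\mathbb{S}^n$ except for a set of measure zero, any regular second order stationary point $R$ of $$\text{(SDPLR1)}\quad\min\left\{\tfrac12\langle C,RR^\top\rangle:\ R\in\mathbb{R}^{n\times r},\ \mathcal{A}(RR^\top)=b,\ R^\top e=0,\ \|R\|_2\le\sqrt\alpha\right\}$$ is a global minimizer of (SDPLR1). Moreover, for such an $R$, if $(y,z)\in\mathbb{R}^{m-1}\times\mathbb{R}^r$ and $\Theta\in\mathcal{N}_{\Omega^2_\alpha}(R)$ satisfy the first order KKT system $(C-\mathcal{A}^*(y))R-ez^\top=-\Theta$, then $g_R^*(y,z)=CR+\Theta$, and since $g_R$ is onto, $$(y,z)=(g_R\,g_R^* )^{-1}g_R(CR+\Theta),$$ so that the dual variable is recovered from $R$ and $\Theta$.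
   Context: $\mathbb{S}^n$ is the space of real symmetric $n\times n$ matrices; $\langle\cdot,\cdot\rangle$ is the trace inner product. Data: linear $\mathcal{A}:\mathbb{S}^n\to\mathbb{R}^{m-1}$ with adjoint $\mathcal{A}^*$, $b\in\mathbb{R}^{m-1}$, $\alpha>0$; $e\in\mathbb{R}^n$ is the all-ones vector; $\|\cdot\|_2$ is the spectral norm. $\Omega^2_\alpha:=\{R\in\mathbb{R}^{n\times r}:\|R\|_2\le\sqrt\alpha\}$ with (convex) normal cone $\mathcal{N}_{\Omega^2_\alpha}(R)$. $G(R):=\left(\frac{\mathcal{A}(RR^\top)-b}{2},R^\top e,R\right)$ and $\mathcal{K}:=\{0\}^{m-1}\times\{0\}^r\times\Omega^2_\alpha$, so (SDPLR1) is $\min\{\frac12\langle C,RR^\top\rangle:G(R)\in\mathcal{K}\}$. $g_R(H):=\left(\frac12\mathcal{A}(RH^\top+HR^\top),H^\top e\right)$, a linear map $\mathbb{R}^{n\times r}\to\mathbb{R}^{m-1}\times\mathbb{R}^r$ with adjoint $g_R^*(y,z)=\mathcal{A}^*(y)R+ez^\top$; $G'(R)[H]=(g_R(H),H)$ and $G''(R)[H,H]=(\mathcal{A}(HH^\top),0,0)$. Regular: let $U_1,V_1$ be the matrices of left and right singular vectors in an SVD of $R$ for the singular values equal to $\sqrt\alpha$ (possibly none), and $\Gamma_R:=\{H\in\mathbb{R}^{n\times r}:U_1^\top HV_1+V_1^\top H^\top U_1=0\}$ (all of $\mathbb{R}^{n\times r}$ if there are none). A point $R$ with $G(R)\in\mathcal{K}$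 is regular if $g_R(\Gamma_R)=\mathbb{R}^{m-1}\times\mathbb{R}^r$ (constraint nondegeneracy). Second order stationary point: (1) $G(R)\in\mathcal{K}$ and there is $(y,z)\in\mathbb{R}^{m-1}\times\mathbb{R}^r$ with $(C-\mathcal{A}^*(y))R-ez^\top\in-\mathcal{N}_{\Omega^2_\alpha}(R)$; (2) for all $d,w\in\mathbb{R}^{n\times r}$ with $G'(R)d\in\mathcal{T}_{\mathcal{K}}(G(R))$ and $G'(R)w+G''(R)[d,d]\in\mathcal{T}^{i,2}_{\mathcal{K}}(G(R),G'(R)d)$: if $\langle CR,d\rangle=0$ then $\langle CR,w\rangle+\langle Cd,d\rangle\ge0$. Here $\mathcal{T}_{\mathcal{K}}(x)$ is the tangent cone of the closed convex set $\mathcal{K}$ at $x$, and $\mathcal{T}^{i,2}_{\mathcal{K}}(x,h):=\{v:\ \mathrm{dist}(x+th+\frac12t^2v,\mathcal{K})=o(t^2),\ t\ge0\}$. *)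

theory Defs
  imports "HOL-Analysis.Analysis"
begin

section \<open>The Euclidean space of real symmetric matrices\<close>

text \<open>
  Symmetric matrices form a type of their own with the trace inner product, so that \<^const>\<open>lborel\<close>
  on it is Lebesgue measure on the space of symmetric matrices (and not on all square matrices),
  and \<^const>\<open>adjoint\<close> of a linear map on it takes symmetric values.
  \<open>Symm\<close> is only meaningful on symmetric arguments.
\<close>

typedef ('n::finite) symm = "{X :: real^'n^'n. transpose X = X}"
  morphisms mat_of Symm
  by (rule exI[of _ 0]) (simp add: transpose_def vec_eq_iff)

setup_lifting type_definition_symm

instantiation symm :: (finite) real_vector
begin

lift_definition zero_symm :: "'a symm" is 0
  by (simp add: transpose_def vec_eq_iff)
lift_definition plus_symm :: "'a symm \<Rightarrow> 'a symm \<Rightarrow> 'a symm" is "(+)"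
  by (simp add: transpose_def vec_eq_iff)
lift_definition minus_symm :: "'a symm \<Rightarrow> 'a symm \<Rightarrow> 'a symm" is "(-)"
  by (simp add: transpose_def vec_eq_iff)
lift_definition uminus_symm :: "'a symm \<Rightarrow> 'a symm" is uminus
  by (simp add: transpose_def vec_eq_iff)
lift_definition scaleR_symm :: "real \<Rightarrow> 'a symm \<Rightarrow> 'a symm" is scaleR
  by (simp add: transpose_def vec_eq_iff)
instance
proof
  fix X Y Z :: "'a symm" and a c :: real
  show "X + Y + Z = X + (Y + Z)" by transfer (rule add.assoc)
  show "X + Y = Y + X" by transfer (rule add.commute)
  show "0 + X = X" by transfer simp
  show "- X + X = 0" by transfer simp
  show "X - Y = X + - Y" by transfer simp
  show "a *\<^sub>R (X + Y) = a *\<^sub>R X + a *\<^sub>R Y" by transfer (rule scaleR_add_right)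
  show "(a + c) *\<^sub>R X = a *\<^sub>R X + c *\<^sub>R X" by transfer (rule scaleR_add_left)
  show "a *\<^sub>R c *\<^sub>R X = (a * c) *\<^sub>R X" by transfer simp
  show "1 *\<^sub>R X = X" by transfer simp
qed

end

instantiation symm :: (finite) real_inner
begin

lift_definition inner_symm :: "'a symm \<Rightarrow> 'a symm \<Rightarrow> real" is inner .
lift_definition norm_symm :: "'a symm \<Rightarrow> real" is norm .

definition sgn_symm :: "'a symm \<Rightarrow> 'a symm" where
  "sgn_symm X = X /\<^sub>R norm X"
definition dist_symm :: "'a symm \<Rightarrow> 'a symm \<Rightarrow> real" where
  "dist_symm X Y = norm (X - Y)"
definition uniformity_symm :: "('a symm \<times> 'a symm) filter" where
  "uniformity_symm = (INF e\<in>{0<..}. principal {(X, Y). dist X Y < e})"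
definition open_symm :: "'a symm set \<Rightarrow> bool" where
  "open_symm S \<longleftrightarrow> (\<forall>X\<in>S. \<forall>\<^sub>F (X', Y) in uniformity. X' = X \<longrightarrow> Y \<in> S)"

instance
proof
  fix X Y Z :: "'a symm" and a :: real and S :: "'a symm set"
  show "sgn X = X /\<^sub>R norm X" by (rule sgn_symm_def)
  show "dist X Y = norm (X - Y)" by (rule dist_symm_def)
  show "(uniformity :: ('a symm \<times> 'a symm) filter)
      = (INF e\<in>{0<..}. principal {(X, Y). dist X Y < e})" by (rule uniformity_symm_def)
  show "open S \<longleftrightarrow> (\<forall>X\<in>S. \<forall>\<^sub>F (X', Y) in uniformity. X' = X \<longrightarrow> Y \<in> S)"
    by (rule open_symm_def)
  show "inner X Y = inner Y X" by transfer (rule inner_commute)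
  show "inner (X + Y) Z = inner X Z + inner Y Z" by transfer (rule inner_add_left)
  show "inner (a *\<^sub>R X) Y = a * inner X Y" by transfer simp
  show "0 \<le> inner X X" by transfer simp
  show "inner X X = 0 \<longleftrightarrow> X = 0" by transfer simp
  show "norm X = sqrt (inner X X)" by transfer (rule norm_eq_sqrt_inner)
qed

end

definition symm_unit :: "'n \<Rightarrow> 'n \<Rightarrow> 'n::finite symm" where
  "symm_unit i j = Symm (axis i (axis j 1) + axis j (axis i 1))"

lemma mat_of_symm_unit: "mat_of (symm_unit i j) = axis i (axis j 1) + axis j (axis i 1)"
  unfolding symm_unit_def
  by (rule Symm_inverse) (auto simp: transpose_def vec_eq_iff axis_def)

lemma mat_of_symmetric: "mat_of X $ i $ j = mat_of X $ j $ i"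
  using mat_of[of X] by (simp add: transpose_def vec_eq_iff)

lemma inner_symm_unit: "inner X (symm_unit i j) = 2 * mat_of X $ i $ j"
  by (simp add: inner_symm.rep_eq mat_of_symm_unit inner_add_right inner_axis
      mat_of_symmetric[of X j i])

lemma symm_unit_nonzero: "symm_unit i j \<noteq> 0"
proof
  assume "symm_unit i j = 0"
  then have "mat_of (symm_unit i j) $ i $ j = mat_of 0 $ i $ j" by simp
  then show False
    by (simp add: mat_of_symm_unit zero_symm.rep_eq axis_def split: if_splits)
qed

lemma symm_unit_orthogonal:
  assumes "symm_unit i j \<noteq> symm_unit k l"
  shows "inner (symm_unit i j) (symm_unit k l) = 0"
proof -
  have "symm_unit i j = symm_unit j i" by (simp add: symm_unit_def add.commute)
  with assms have "\<not> (i = k \<and> j = l)" "\<not> (j = k \<and> i = l)" by auto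
  then show ?thesis by (auto simp: inner_symm_unit mat_of_symm_unit axis_def)
qed

instantiation symm :: (finite) euclidean_space
begin

definition Basis_symm :: "'a symm set" where
  "Basis_symm = range (\<lambda>(i, j). sgn (symm_unit i j))"

instance
proof
  show "(Basis :: 'a symm set) \<noteq> {}" by (simp add: Basis_symm_def)
  show "finite (Basis :: 'a symm set)" by (simp add: Basis_symm_def)
next
  fix U V :: "'a symm"
  assume "U \<in> Basis" "V \<in> Basis"
  then obtain i j k l where U: "U = sgn (symm_unit i j)" and V: "V = sgn (symm_unit k l)"
    by (auto simp: Basis_symm_def)
  show "inner U V = (if U = V then 1 else 0)"
  proof (cases "U = V")
    case True
    have "norm U = 1" by (simp add: U norm_sgn symm_unit_nonzero)
    then show ?thesis using True by (simp add: norm_eq_1)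
  next
    case False
    then have "symm_unit i j \<noteq> symm_unit k l" using U V by auto
    then show ?thesis using False
      by (simp add: U V sgn_div_norm symm_unit_orthogonal)
  qed
next
  fix X :: "'a symm"
  show "(\<forall>U\<in>Basis. inner X U = 0) \<longleftrightarrow> X = 0"
  proof
    assume "\<forall>U\<in>Basis. inner X U = 0"
    then have "inner X (sgn (symm_unit i j)) = 0" for i j
      by (auto simp: Basis_symm_def)
    then have "mat_of X $ i $ j = 0" for i j
      by (simp add: sgn_div_norm symm_unit_nonzero inner_symm_unit)
    then have "mat_of X = 0" by (simp add: vec_eq_iff)
    then show "X = 0" by transfer
  qed simp
qed

end

section \<open>Convex-analytic and matrix notions\<close>

definition normal_cone :: "'a::real_inner set \<Rightarrow> 'a \<Rightarrow> 'a set" where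
  "normal_cone S x = {v. x \<in> S \<and> (\<forall>y\<in>S. inner v (y - x) \<le> 0)}"

text \<open>For convex \<open>S\<close> and \<open>x \<in> S\<close>, the only case used below.\<close>

definition tangent_cone :: "'a::real_normed_vector set \<Rightarrow> 'a \<Rightarrow> 'a set" where
  "tangent_cone S x = closure (cone hull ((\<lambda>y. y - x) ` S))"

definition inner_tangent2 :: "'a::real_normed_vector set \<Rightarrow> 'a \<Rightarrow> 'a \<Rightarrow> 'a set" where
  "inner_tangent2 S x h =
     {v. (\<lambda>t::real. infdist (x + t *\<^sub>R h + (t\<^sup>2 / 2) *\<^sub>R v) S) \<in> o[at_right 0](\<lambda>t. t\<^sup>2)}"

definition psd :: "'n::finite symm \<Rightarrow> bool" where
  "psd X \<longleftrightarrow> (\<forall>x. 0 \<le> x \<bullet> (mat_of X *v x))"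

definition outer :: "real^'n \<Rightarrow> real^'r \<Rightarrow> real^'r^'n" where
  "outer x y = (\<chi> i j. x $ i * y $ j)"

abbreviation ones :: "real^'n" where
  "ones \<equiv> (\<chi> i. 1)"

definition spectral_norm :: "real^'r^'n \<Rightarrow> real" where
  "spectral_norm R = onorm ((*v) R)"

text \<open>
  A (thin) singular value decomposition, with the \<open>min n r\<close> singular triples indexed by \<open>nat\<close>
  in no particular order.
\<close>

definition is_svd ::
    "real^'r^'n \<Rightarrow> (nat \<Rightarrow> real^'n) \<Rightarrow> (nat \<Rightarrow> real^'r) \<Rightarrow> (nat \<Rightarrow> real) \<Rightarrow> bool" where
  "is_svd R u v \<sigma> \<longleftrightarrow>
     (let p = min CARD('n) CARD('r) in
       (\<forall>i<p. \<forall>j<p. u i \<bullet> u j = (if i = j then 1 else 0)) \<and>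
       (\<forall>i<p. \<forall>j<p. v i \<bullet> v j = (if i = j then 1 else 0)) \<and>
       (\<forall>i<p. 0 \<le> \<sigma> i) \<and>
       R = (\<Sum>i<p. \<sigma> i *\<^sub>R outer (u i) (v i)))"

section \<open>The semidefinite program and its low-rank formulation (SDPLR1)\<close>

text \<open>
  Throughout, \<open>A :: 'n symm \<Rightarrow> real^'k\<close> is the linear constraint map, so that
  \<open>CARD('k) = m - 1\<close>, and \<open>R :: real^'r^'n\<close> is an \<open>n \<times> r\<close> matrix.
\<close>

definition sdp_feasible :: "('n::finite symm \<Rightarrow> real^'k) \<Rightarrow> real^'k \<Rightarrow> 'n symm set" where
  "sdp_feasible A b = {X. A X = b \<and> mat_of X *v ones = 0 \<and> psd X}"

definition Omega2 :: "real \<Rightarrow> (real^'r^'n) set" where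
  "Omega2 \<alpha> = {R. spectral_norm R \<le> sqrt \<alpha>}"

definition sdplr1_feasible ::
    "('n::finite symm \<Rightarrow> real^'k) \<Rightarrow> real^'k \<Rightarrow> real \<Rightarrow> (real^'r^'n) set" where
  "sdplr1_feasible A b \<alpha> =
     {R. A (Symm (R ** transpose R)) = b \<and> transpose R *v ones = 0 \<and> spectral_norm R \<le> sqrt \<alpha>}"

definition sdplr1_objective :: "'n::finite symm \<Rightarrow> real^'r^'n \<Rightarrow> real" where
  "sdplr1_objective C R = (1/2) * (C \<bullet> Symm (R ** transpose R))"

definition sdplr1_global_minimizer ::
    "('n::finite symm \<Rightarrow> real^'k) \<Rightarrow> real^'k \<Rightarrow> real \<Rightarrow> 'n symm \<Rightarrow> real^'r^'n \<Rightarrow> bool" where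
  "sdplr1_global_minimizer A b \<alpha> C R \<longleftrightarrow>
     R \<in> sdplr1_feasible A b \<alpha> \<and>
     (\<forall>S\<in>(sdplr1_feasible A b \<alpha> :: (real^'r^'n) set). sdplr1_objective C R \<le> sdplr1_objective C S)"

definition Gmap :: "('n::finite symm \<Rightarrow> real^'k) \<Rightarrow> real^'k \<Rightarrow> real^'r^'n
    \<Rightarrow> (real^'k) \<times> (real^'r) \<times> (real^'r^'n)" where
  "Gmap A b R = ((1/2) *\<^sub>R (A (Symm (R ** transpose R)) - b), transpose R *v ones, R)"

definition Kset :: "real \<Rightarrow> ((real^'k) \<times> (real^'r) \<times> (real^'r^'n)) set" where
  "Kset \<alpha> = {0} \<times> {0} \<times> Omega2 \<alpha>"

definition gmap :: "('n::finite symm \<Rightarrow> real^'k) \<Rightarrow> real^'r^'n \<Rightarrow> real^'r^'n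
    \<Rightarrow> (real^'k) \<times> (real^'r)" where
  "gmap A R H =
     ((1/2) *\<^sub>R A (Symm (R ** transpose H + H ** transpose R)), transpose H *v ones)"

text \<open>First derivative of \<open>Gmap\<close> at \<open>R\<close>, and the quadratic form of its second derivative.\<close>

definition Gmap' :: "('n::finite symm \<Rightarrow> real^'k) \<Rightarrow> real^'r^'n \<Rightarrow> real^'r^'n
    \<Rightarrow> (real^'k) \<times> (real^'r) \<times> (real^'r^'n)" where
  "Gmap' A R H = (fst (gmap A R H), snd (gmap A R H), H)"

definition Gmap'' :: "('n::finite symm \<Rightarrow> real^'k) \<Rightarrow> real^'r^'n
    \<Rightarrow> (real^'k) \<times> (real^'r) \<times> (real^'r^'n)" where
  "Gmap'' A H = (A (Symm (H ** transpose H)), 0, 0)"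

text \<open>
  With \<open>U\<^sub>1\<close>, \<open>V\<^sub>1\<close> the matrices whose columns are the \<open>u i\<close>, \<open>v i\<close> with \<open>\<sigma> i = sqrt \<alpha>\<close>,
  the condition below is the vanishing of the \<open>(i, j)\<close> entry of \<open>U\<^sub>1\<^sup>T H V\<^sub>1 + V\<^sub>1\<^sup>T H\<^sup>T U\<^sub>1\<close>.
\<close>

definition Gamma_space ::
    "real \<Rightarrow> (nat \<Rightarrow> real^'n) \<Rightarrow> (nat \<Rightarrow> real^'r) \<Rightarrow> (nat \<Rightarrow> real) \<Rightarrow> (real^'r^'n) set" where
  "Gamma_space \<alpha> u v \<sigma> =
     (let I = {i. i < min CARD('n) CARD('r) \<and> \<sigma> i = sqrt \<alpha>} in
       {H. \<forall>i\<in>I. \<forall>j\<in>I. u i \<bullet> (H *v v j) + v i \<bullet> (transpose H *v u j) = 0})"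

text \<open>
  \<open>Gamma_space\<close> does not depend on the choice of the singular value decomposition of \<open>R\<close>,
  so the existential quantifier only picks one.
\<close>

definition regular_point ::
    "('n::finite symm \<Rightarrow> real^'k) \<Rightarrow> real^'k \<Rightarrow> real \<Rightarrow> real^'r^'n \<Rightarrow> bool" where
  "regular_point A b \<alpha> R \<longleftrightarrow>
     Gmap A b R \<in> Kset \<alpha> \<and>
     (\<exists>u v \<sigma>. is_svd R u v \<sigma> \<and> gmap A R ` Gamma_space \<alpha> u v \<sigma> = UNIV)"

definition second_order_stationary ::
    "('n::finite symm \<Rightarrow> real^'k) \<Rightarrow> real^'k \<Rightarrow> real \<Rightarrow> 'n symm \<Rightarrow> real^'r^'n \<Rightarrow> bool" where
  "second_order_stationary A b \<alpha> C R \<longleftrightarrow>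
     Gmap A b R \<in> Kset \<alpha> \<and>
     (\<exists>y z. mat_of (C - adjoint A y) ** R - outer ones z \<in> uminus ` normal_cone (Omega2 \<alpha>) R) \<and>
     (\<forall>d w. Gmap' A R d \<in> tangent_cone (Kset \<alpha>) (Gmap A b R) \<longrightarrow>
        Gmap' A R w + Gmap'' A d \<in> inner_tangent2 (Kset \<alpha>) (Gmap A b R) (Gmap' A R d) \<longrightarrow>
        (mat_of C ** R) \<bullet> d = 0 \<longrightarrow>
        0 \<le> (mat_of C ** R) \<bullet> w + (mat_of C ** d) \<bullet> d)"

end

theory Submission
  imports Defs
begin

text \<open>
  The proof combines a dimension count, which shows that for almost every \<open>C\<close> a stationary \<open>R\<close> has
  a nontrivial kernel, with a second order argument along that kernel.

  \<^bold>\<open>Rank deficiency.\<close> Let \<open>\<Theta>\<close> be normal to the spectral norm ball at \<open>R\<close>. Then \<open>\<Theta>\<close> vanishes on the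
  orthogonal complement \<open>F\<close> of the right singular vectors with singular value \<open>sqrt \<alpha>\<close>
  (\<open>normal_cone_Omega2_complementary\<close>). As \<open>R R\<^sup>T\<close> is feasible for the semidefinite program, that
  singular value occurs at most \<open>\<beta> / \<alpha>\<close> times (\<open>dim_top_singular_space\<close>), so
  \<open>q = dim F\<close> satisfies \<open>q\<^sup>2 \<ge> 2 m\<close>. On \<open>F\<close> the stationarity equation says that \<open>C - A\<^sup>* y\<close> maps
  \<open>R F\<close> into the line of \<open>ones\<close>, and \<open>R F\<close> is orthogonal to \<open>ones\<close>. If \<open>R\<close> were injective, \<open>R F\<close> would
  have dimension \<open>q\<close>. The symmetric matrices with such a \<open>q\<close>-dimensional space form
  a set of codimension \<open>q (q + 1) / 2\<close>, and \<open>y\<close> has only \<open>m - 1 < q (q + 1) / 2\<close> components; so the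
  set of these \<open>C\<close> is negligible (\<open>negligible_large_corank\<close>).

  \<^bold>\<open>Second order condition.\<close> So \<open>R *v x = 0\<close> for some unit vector \<open>x\<close>. For each \<open>h\<close> orthogonal to
  \<open>ones\<close>, the direction \<open>h x\<^sup>T\<close> is tangent. Moving along it raises the top eigenvalues of \<open>R R\<^sup>T\<close> at
  second order only, and this is compensated by \<open>- h h\<^sup>T R / \<alpha>\<close> (\<open>second_order_curve\<close>);
  regularity allows a further correction in \<open>Gamma_space\<close> that restores the linear constraints. The
  second order inequality then says that \<open>C - A\<^sup>* y + N\<close>, with
  \<open>N = \<Theta> R\<^sup>T / \<alpha>\<close>, is positive semidefinite on the complement of \<open>ones\<close>
  (\<open>curvature_of_second_order\<close>).

  \<^bold>\<open>Global optimality.\<close> The KKT system says that \<open>(C - A\<^sup>* y + N) R = ones z\<^sup>T\<close>, and \<open>R R\<^sup>T\<close> maximises the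
  inner product with \<open>N\<close> over the ball (\<open>normal_cone_Omega2_trace_max\<close>). These are the
  optimality conditions of the convex problem in \<open>X = R R\<^sup>T\<close> with the constraint
  \<open>X \<le> \<alpha> I\<close>, so \<open>R\<close> is a global minimiser (\<open>global_minimizer_of_certificate\<close>).

  The formula for the multipliers holds at every regular point, for every \<open>C\<close>: \<open>g g\<^sup>*\<close> is
  invertible whenever \<open>g\<close> is onto (\<open>bij_compose_adjoint\<close>).
\<close>

section \<open>Matrix identities\<close>

lemma inner_matrix_mult_left:
  fixes X :: "real^'b^'a" and Y :: "real^'c^'b" and Z :: "real^'c^'a"
  shows "(X ** Y) \<bullet> Z = Y \<bullet> (transpose X ** Z)"
proof -
  have "(X ** Y) \<bullet> Z = (\<Sum>i\<in>UNIV. \<Sum>j\<in>UNIV. \<Sum>k\<in>UNIV. X$i$k * Y$k$j * Z$i$j)"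
    by (simp add: inner_vec_def matrix_matrix_mult_def sum_distrib_right)
  also have "\<dots> = (\<Sum>i\<in>UNIV. \<Sum>k\<in>UNIV. \<Sum>j\<in>UNIV. X$i$k * Y$k$j * Z$i$j)"
    by (intro sum.cong refl) (rule sum.swap)
  also have "\<dots> = (\<Sum>k\<in>UNIV. \<Sum>i\<in>UNIV. \<Sum>j\<in>UNIV. X$i$k * Y$k$j * Z$i$j)"
    by (rule sum.swap)
  also have "\<dots> = (\<Sum>k\<in>UNIV. \<Sum>j\<in>UNIV. \<Sum>i\<in>UNIV. X$i$k * Y$k$j * Z$i$j)"
    by (intro sum.cong refl) (rule sum.swap)
  also have "\<dots> = Y \<bullet> (transpose X ** Z)"
    by (simp add: inner_vec_def matrix_matrix_mult_def transpose_def sum_distrib_left ac_simps)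
  finally show ?thesis .
qed

lemma inner_transpose: "transpose X \<bullet> transpose Y = X \<bullet> (Y :: real^'b^'a)"
  by (simp add: inner_vec_def transpose_def) (rule sum.swap)

lemma inner_matrix_mult_right:
  fixes X :: "real^'b^'a" and Y :: "real^'c^'b" and Z :: "real^'c^'a"
  shows "(X ** Y) \<bullet> Z = X \<bullet> (Z ** transpose Y)"
proof -
  have "(X ** Y) \<bullet> Z = (transpose Y ** transpose X) \<bullet> transpose Z"
    by (simp add: inner_transpose flip: matrix_transpose_mul)
  also have "\<dots> = transpose X \<bullet> transpose (Z ** transpose Y)"
    by (simp add: inner_matrix_mult_left matrix_transpose_mul)
  finally show ?thesis by (simp add: inner_transpose)
qed

lemma inner_outer: "outer a b \<bullet> X = a \<bullet> (X *v b)"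
  by (simp add: inner_vec_def outer_def matrix_vector_mult_def sum_distrib_left ac_simps)

lemma outer_mult_vec: "outer a b *v x = (b \<bullet> x) *\<^sub>R a"
  by (simp add: vec_eq_iff outer_def matrix_vector_mult_def inner_vec_def sum_distrib_left
      sum_distrib_right ac_simps)

lemma vec_mult_outer: "x v* outer a b = (a \<bullet> x) *\<^sub>R b"
  by (simp add: vec_eq_iff outer_def vector_matrix_mult_def inner_vec_def sum_distrib_left
      sum_distrib_right ac_simps)

lemma transpose_outer: "transpose (outer a b) = outer b a"
  by (simp add: vec_eq_iff outer_def transpose_def ac_simps)

lemma mult_outer: "X ** outer a b = outer (X *v a) b"
  by (simp add: vec_eq_iff outer_def matrix_matrix_mult_def matrix_vector_mult_def
      sum_distrib_left ac_simps)

lemma outer_mult: "outer a b ** X = outer a (b v* X)"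
  by (simp add: vec_eq_iff outer_def matrix_matrix_mult_def vector_matrix_mult_def
      sum_distrib_left ac_simps)

lemma outer_zero [simp]: "outer 0 b = 0" "outer a 0 = 0"
  by (simp_all add: vec_eq_iff outer_def)

lemma transpose_add: "transpose (X + Y) = transpose X + transpose (Y :: real^'b^'a)"
  by (simp add: vec_eq_iff transpose_def)

lemma transpose_scaleR: "transpose (c *\<^sub>R X) = c *\<^sub>R transpose (X :: real^'b^'a)"
  by (simp add: vec_eq_iff transpose_def)

lemma matrix_add_rdistrib: "(A + B) ** C = A ** C + B ** (C :: real^'c^'b)"
  by (simp add: vec_eq_iff matrix_matrix_mult_def distrib_right sum.distrib)

lemma matrix_diff_rdistrib: "(A - B) ** C = A ** C - B ** (C :: real^'c^'b)"
  by (simp add: vec_eq_iff matrix_matrix_mult_def left_diff_distrib sum_subtractf)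

lemma matrix_scaleR_left: "(c *\<^sub>R A) ** B = c *\<^sub>R (A ** (B :: real^'c^'b))"
  by (simp add: vec_eq_iff matrix_matrix_mult_def sum_distrib_left ac_simps)

lemma matrix_scaleR_right: "A ** (c *\<^sub>R B) = c *\<^sub>R (A ** (B :: real^'c^'b))"
  by (simp add: vec_eq_iff matrix_matrix_mult_def sum_distrib_left ac_simps)

lemma norm_add_sq: "(norm (a + b))\<^sup>2 = (norm a)\<^sup>2 + 2 * (a \<bullet> b) + (norm (b :: 'a::real_inner))\<^sup>2"
  by (simp add: power2_norm_eq_inner inner_add_left inner_add_right inner_commute)

lemma sq_le_of_bound: "norm y \<le> c * norm x \<Longrightarrow> (norm y)\<^sup>2 \<le> c\<^sup>2 * (norm x)\<^sup>2"
  by (metis norm_ge_zero power_mono power_mult_distrib)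

lemma linear_vec_mult_right: "linear (\<lambda>Y. x v* (Y :: real^'b^'a))"
  by (rule linearI) (simp_all add: vector_matrix_mult_add_rdistrib vector_scaleR_matrix_ac)

lemma linear_vec_mult_left: "linear (\<lambda>x. x v* (Y :: real^'b^'a))"
  by (rule linearI) (simp_all add: vector_matrix_left_distrib scaleR_vector_matrix_assoc)

section \<open>The spectral norm ball and its normal cone\<close>

lemma norm_matvec_bound:
  fixes Y :: "real^'b^'a"
  obtains c where "0 \<le> c" "\<And>x. norm (Y *v x) \<le> c * norm x"
    "\<And>u. norm (u v* Y) \<le> c * norm u"
proof -
  have 1: "\<exists>c\<ge>0. \<forall>x. norm (Z *v x) \<le> c * norm x" for Z :: "real^'m^'k"
    using bounded_linear.nonneg_bounded[OF matrix_vector_mul_bounded_linear[of Z]]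
    by (auto simp: mult.commute)
  obtain c where c: "0 \<le> c" "\<And>x. norm (Y *v x) \<le> c * norm x" using 1 by metis
  obtain d where d: "0 \<le> d" "\<And>x. norm (transpose Y *v x) \<le> d * norm x" using 1 by metis
  have "c * norm x \<le> max c d * norm x" "d * norm u \<le> max c d * norm u" for x :: "real^'b" and u :: "real^'a"
    by (auto intro: mult_right_mono)
  then have "norm (Y *v x) \<le> max c d * norm x" "norm (u v* Y) \<le> max c d * norm u" for x u
    using c(2)[of x] d(2)[of u] by (fastforce intro: order_trans simp del: mult_le_cancel_right)+
  then show ?thesis using c(1) that[of "max c d"] by auto
qed

text \<open>
  A matrix and its transpose have the same operator norm: \<open>norm (Y *v x)\<close> squared is the inner product
  of \<open>x\<close> and \<open>(Y *v x) v* Y\<close>. This gives the freedom to estimate a perturbation of \<open>R\<close> on the side on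
  which it is simpler.
\<close>

lemma sq_le_transpose:
  fixes Y :: "real^'b^'a"
  assumes "0 \<le> c" and u: "\<And>u. (norm (u v* Y))\<^sup>2 \<le> c * (norm u)\<^sup>2"
  shows "(norm (Y *v x))\<^sup>2 \<le> c * (norm x)\<^sup>2"
proof (cases "Y *v x = 0")
  case False
  let ?n = "norm (Y *v x)"
  have "?n\<^sup>2 = x \<bullet> ((Y *v x) v* Y)"
    by (metis dot_lmul_matrix inner_commute power2_norm_eq_inner)
  also have "\<dots> \<le> norm x * norm ((Y *v x) v* Y)" by (rule norm_cauchy_schwarz)
  finally have "(?n\<^sup>2)\<^sup>2 \<le> (norm x)\<^sup>2 * (norm ((Y *v x) v* Y))\<^sup>2"
    by (metis power_mono power_mult_distrib zero_le_power2)
  also have "\<dots> \<le> (norm x)\<^sup>2 * (c * ?n\<^sup>2)" by (intro mult_left_mono u) simp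
  finally have "?n\<^sup>2 * ?n\<^sup>2 \<le> (c * (norm x)\<^sup>2) * ?n\<^sup>2"
    by (simp add: power2_eq_square ac_simps)
  moreover have "0 < ?n\<^sup>2" using False by simp
  ultimately show ?thesis by (rule mult_right_le_imp_le)
qed (use assms in simp)

lemma Omega2_iff:
  assumes "0 < \<alpha>"
  shows "Y \<in> Omega2 \<alpha> \<longleftrightarrow> (\<forall>x. (norm (Y *v x))\<^sup>2 \<le> \<alpha> * (norm x)\<^sup>2)" (is "?L \<longleftrightarrow> ?R")
proof
  assume ?L
  then have "norm (Y *v x) \<le> sqrt \<alpha> * norm x" for x
    using onorm[OF matrix_vector_mul_bounded_linear[of Y], of x]
      mult_right_mono[of "onorm ((*v) Y)" "sqrt \<alpha>" "norm x"]
    by (simp add: Omega2_def spectral_norm_def)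
  then have "(norm (Y *v x))\<^sup>2 \<le> (sqrt \<alpha> * norm x)\<^sup>2" for x
    by (intro power_mono) auto
  then show ?R using assms by (simp add: power_mult_distrib)
next
  assume R: ?R
  have "norm (Y *v x) \<le> sqrt \<alpha> * norm x" for x
  proof (rule power2_le_imp_le)
    show "(norm (Y *v x))\<^sup>2 \<le> (sqrt \<alpha> * norm x)\<^sup>2" using R assms by (simp add: power_mult_distrib)
  qed (use assms in auto)
  then show ?L by (simp add: Omega2_def spectral_norm_def onorm_le)
qed

lemma Omega2_iff_left:
  assumes "0 < \<alpha>"
  shows "Y \<in> Omega2 \<alpha> \<longleftrightarrow> (\<forall>u. (norm (u v* Y))\<^sup>2 \<le> \<alpha> * (norm u)\<^sup>2)"
  using assms sq_le_transpose[of \<alpha> Y] sq_le_transpose[of \<alpha> "transpose Y"]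
  by (auto simp: Omega2_iff)

text \<open>
  The factor \<open>1 + c / \<alpha>\<close> is larger than the necessary \<open>sqrt (1 + c / \<alpha>)\<close>; the distance it costs is
  still of order \<open>c\<close>, and no square roots appear.
\<close>

lemma Omega2_rescale:
  assumes "0 < \<alpha>" "0 \<le> c" and u: "\<And>u. (norm (u v* Y))\<^sup>2 \<le> (\<alpha> + c) * (norm u)\<^sup>2"
  shows "(1 / (1 + c / \<alpha>)) *\<^sub>R Y \<in> Omega2 \<alpha>"
  unfolding Omega2_iff_left[OF assms(1)]
proof
  fix u
  let ?s = "1 + c / \<alpha>"
  have s: "1 \<le> ?s" using assms by simp
  have "(norm (u v* Y))\<^sup>2 \<le> \<alpha> * ?s * (norm u)\<^sup>2"
    using u[of u] assms by (simp add: distrib_left)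
  also have "\<dots> \<le> \<alpha> * (?s\<^sup>2) * (norm u)\<^sup>2"
    using s assms by (intro mult_right_mono mult_left_mono) (auto intro: self_le_power)
  finally have "(norm (u v* Y))\<^sup>2 \<le> ?s\<^sup>2 * (\<alpha> * (norm u)\<^sup>2)" by (simp add: ac_simps)
  moreover have "(norm (u v* ((1 / ?s) *\<^sub>R Y)))\<^sup>2 = (norm (u v* Y))\<^sup>2 / ?s\<^sup>2"
    using s by (simp add: vector_scaleR_matrix_ac power_divide power_mult_distrib)
  moreover have "0 < ?s\<^sup>2" using s by (intro zero_less_power) linarith
  ultimately show "(norm (u v* ((1 / ?s) *\<^sub>R Y)))\<^sup>2 \<le> \<alpha> * (norm u)\<^sup>2"
    by (simp add: pos_divide_le_eq mult.commute)
qed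

lemma Omega2_nearby:
  assumes "0 < \<alpha>" "0 \<le> c" and u: "\<And>u. (norm (u v* Y))\<^sup>2 \<le> (\<alpha> + c) * (norm u)\<^sup>2"
  obtains Z where "Z \<in> Omega2 \<alpha>" "norm (Y - Z) \<le> (c / \<alpha>) * norm Y"
proof
  let ?s = "1 + c / \<alpha>"
  have s: "1 \<le> ?s" using assms by simp
  show "(1 / ?s) *\<^sub>R Y \<in> Omega2 \<alpha>" by (rule Omega2_rescale[OF assms])
  have "Y - (1 / ?s) *\<^sub>R Y = (1 - 1 / ?s) *\<^sub>R Y" by (simp add: algebra_simps)
  then have "norm (Y - (1 / ?s) *\<^sub>R Y) = \<bar>1 - 1 / ?s\<bar> * norm Y" by simp
  also have "\<bar>1 - 1 / ?s\<bar> \<le> c / \<alpha>"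
  proof -
    have "1 - 1 / ?s = (c / \<alpha>) / ?s" using s by (simp add: field_simps)
    moreover have "0 \<le> c / \<alpha>" using assms by simp
    moreover have "(c / \<alpha>) / ?s \<le> (c / \<alpha>) / 1"
      using s \<open>0 \<le> c / \<alpha>\<close> by (intro divide_left_mono) auto
    moreover have "0 \<le> (c / \<alpha>) / ?s" using s \<open>0 \<le> c / \<alpha>\<close> by (meson divide_nonneg_nonneg order_trans zero_le_one)
    ultimately show ?thesis by (simp only: abs_of_nonneg div_by_1)
  qed
  finally show "norm (Y - (1 / ?s) *\<^sub>R Y) \<le> (c / \<alpha>) * norm Y"
    by (simp add: mult_right_mono)
qed

text \<open>
  A curve that leaves the ball only at second order can be scaled back into the ball at second
  order cost, so its velocity is tangent and a normal vector cannot have positive inner product with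
  it. Well chosen curves take the place of a singular value decomposition of \<open>\<Theta>\<close>.
\<close>

lemma normal_cone_Omega2_second_order_curve:
  assumes \<alpha>: "0 < \<alpha>" and \<Theta>: "\<Theta> \<in> normal_cone (Omega2 \<alpha>) R" and c: "0 \<le> c"
    and curve: "\<And>t u. 0 < t \<Longrightarrow> t \<le> 1 \<Longrightarrow>
      (norm (u v* (R + t *\<^sub>R H)))\<^sup>2 \<le> (\<alpha> + c * t\<^sup>2) * (norm u)\<^sup>2"
  shows "\<Theta> \<bullet> H \<le> 0"
proof -
  let ?k = "(c / \<alpha>) * (\<Theta> \<bullet> R)"
  have le: "\<Theta> \<bullet> H \<le> ?k * t" if t: "0 < t" "t \<le> 1" for t
  proof -
    let ?s = "1 + (c * t\<^sup>2) / \<alpha>"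
    have s: "0 < ?s" using \<alpha> c by (simp add: add_pos_nonneg)
    have "(1 / ?s) *\<^sub>R (R + t *\<^sub>R H) \<in> Omega2 \<alpha>"
      using curve[OF t] \<alpha> c by (intro Omega2_rescale) auto
    then have "\<Theta> \<bullet> ((1 / ?s) *\<^sub>R (R + t *\<^sub>R H)) \<le> \<Theta> \<bullet> R"
      using \<Theta> by (auto simp: normal_cone_def inner_diff_right)
    then have "?s * (\<Theta> \<bullet> ((1 / ?s) *\<^sub>R (R + t *\<^sub>R H))) \<le> ?s * (\<Theta> \<bullet> R)"
      using s by (intro mult_left_mono) auto
    then have "\<Theta> \<bullet> (R + t *\<^sub>R H) \<le> ?s * (\<Theta> \<bullet> R)"
      using s by (simp add: inner_scaleR_right del: scaleR_add_right)
    then have "t * (\<Theta> \<bullet> H) \<le> t * (?k * t)"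
      by (simp add: inner_add_right algebra_simps power2_eq_square)
    with t(1) show ?thesis by (simp only: mult_le_cancel_left_pos)
  qed
  show ?thesis
  proof (rule tendsto_lowerbound)
    show "((\<lambda>t. ?k * t) \<longlongrightarrow> 0) (at_right 0)"
      by (rule tendsto_eq_intros refl)+ simp
    show "\<forall>\<^sub>F t in at_right 0. \<Theta> \<bullet> H \<le> ?k * t"
      unfolding eventually_at_right_field by (intro exI[of _ 1] conjI allI impI le) auto
  qed simp
qed

text \<open>
  The matrix \<open>B = \<alpha> I - R R\<^sup>T\<close> satisfies \<open>0 \<le> B \<le> \<alpha> I\<close>, hence \<open>B\<^sup>2 \<le> \<alpha> B\<close>; the quadratic
  form of \<open>B\<close>, the gap in the constraint \<open>norm (u v* R) \<le> sqrt \<alpha> * norm u\<close>, is on the right. This gap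
  absorbs all cross terms that are linear in \<open>B *v u\<close>.
\<close>

lemma spectral_gap_bound:
  fixes R :: "real^'b^'a"
  assumes \<alpha>: "0 < \<alpha>" and R: "\<And>x. (norm (R *v x))\<^sup>2 \<le> \<alpha> * (norm x)\<^sup>2"
  shows "(norm (\<alpha> *\<^sub>R u - R *v (u v* R)))\<^sup>2 \<le> \<alpha> * (\<alpha> * (norm u)\<^sup>2 - (norm (u v* R))\<^sup>2)"
proof -
  have "u \<bullet> (R *v (u v* R)) = (norm (u v* R))\<^sup>2"
    by (simp add: power2_norm_eq_inner dot_lmul_matrix)
  then have "(norm (\<alpha> *\<^sub>R u - R *v (u v* R)))\<^sup>2 =
      \<alpha>\<^sup>2 * (norm u)\<^sup>2 - 2 * \<alpha> * (norm (u v* R))\<^sup>2 + (norm (R *v (u v* R)))\<^sup>2"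
    using norm_add_sq[of "\<alpha> *\<^sub>R u" "- (R *v (u v* R))"] by (simp add: power_mult_distrib)
  then show ?thesis using R[of "u v* R"] by (simp add: algebra_simps power2_eq_square)
qed

text \<open>
  With \<open>B = \<alpha> I - R\<^sup>T R\<close>, the claim is \<open>\<Theta> B = 0\<close>: a normal vector lives on the right singular
  vectors with singular value \<open>sqrt \<alpha>\<close>. The curve is \<open>R + t G B\<close>, whose first order change of
  \<open>(norm (R *v x))\<^sup>2\<close> is linear in \<open>B *v x\<close> and is therefore absorbed by the gap. As \<open>G\<close> is
  arbitrary, it may be taken to be \<open>\<Theta> B\<close>.
\<close>

lemma normal_cone_Omega2_complementary:
  fixes R :: "real^'b^'a"
  assumes \<alpha>: "0 < \<alpha>" and \<Theta>: "\<Theta> \<in> normal_cone (Omega2 \<alpha>) R"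
  shows "\<Theta> ** transpose R ** R = \<alpha> *\<^sub>R \<Theta>"
proof -
  have "R \<in> Omega2 \<alpha>" using \<Theta> by (simp add: normal_cone_def)
  then have R: "(norm (u v* R))\<^sup>2 \<le> \<alpha> * (norm u)\<^sup>2" and R': "(norm (R *v x))\<^sup>2 \<le> \<alpha> * (norm x)\<^sup>2" for u x
    using Omega2_iff[OF \<alpha>, of R] Omega2_iff_left[OF \<alpha>, of R] by auto
  define D where "D G = \<alpha> *\<^sub>R G - G ** (transpose R ** R)" for G :: "real^'b^'a"
  have D: "D G *v x = G *v (\<alpha> *\<^sub>R x - (R *v x) v* R)" for G x
    by (simp add: D_def matrix_vector_mult_diff_rdistrib matrix_vector_mult_diff_distrib
        scaleR_matrix_vector_assoc[symmetric] matrix_vector_mult_scaleR flip: matrix_vector_mul_assoc)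
  have neg: "\<Theta> \<bullet> D G \<le> 0" for G
  proof -
    obtain k where k: "0 \<le> k" "\<And>x. norm ((transpose R ** G) *v x) \<le> k * norm x"
      using norm_matvec_bound[of "transpose R ** G"] by metis
    obtain g where g: "0 \<le> g" "\<And>x. norm (G *v x) \<le> g * norm x"
      using norm_matvec_bound[of G] by metis
    let ?c = "\<alpha> * k\<^sup>2 + g\<^sup>2 * \<alpha>\<^sup>2"
    show ?thesis
    proof (rule normal_cone_Omega2_second_order_curve[OF \<alpha> \<Theta>])
      show c: "0 \<le> ?c" using \<alpha> by simp
      fix t :: real and u assume t: "0 < t"
      let ?Y = "R + t *\<^sub>R D G"
      have "(norm (?Y *v x))\<^sup>2 \<le> (\<alpha> + ?c * t\<^sup>2) * (norm x)\<^sup>2" for x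
      proof -
        let ?w = "\<alpha> *\<^sub>R x - (R *v x) v* R"
        have w: "(norm ?w)\<^sup>2 \<le> \<alpha> * (\<alpha> * (norm x)\<^sup>2 - (norm (R *v x))\<^sup>2)"
          using spectral_gap_bound[OF \<alpha>, of "transpose R" x] R by simp
        also have "\<dots> \<le> \<alpha>\<^sup>2 * (norm x)\<^sup>2" using \<alpha> by (simp add: right_diff_distrib power2_eq_square)
        finally have w2: "(norm ?w)\<^sup>2 \<le> \<alpha>\<^sup>2 * (norm x)\<^sup>2" .
        have "(R *v x) \<bullet> (G *v ?w) = x \<bullet> ((transpose R ** G) *v ?w)"
          by (simp add: dot_lmul_matrix inner_commute flip: matrix_vector_mul_assoc)
            (metis dot_lmul_matrix inner_commute)
        also have "\<dots> \<le> norm x * (k * norm ?w)"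
          by (rule order_trans[OF norm_cauchy_schwarz mult_left_mono[OF k(2)]]) simp
        finally have "2 * t * ((R *v x) \<bullet> (G *v ?w)) \<le> 2 * t * (norm x * (k * norm ?w))"
          using t by simp
        also have "\<dots> \<le> (norm ?w)\<^sup>2 / \<alpha> + \<alpha> * (t * k * norm x)\<^sup>2"
        proof -
          have "0 \<le> (norm ?w - \<alpha> * (t * k * norm x))\<^sup>2 / \<alpha>" using \<alpha> by simp
          also have "\<dots> = (norm ?w)\<^sup>2 / \<alpha> + \<alpha> * (t * k * norm x)\<^sup>2 - 2 * t * (norm x * (k * norm ?w))"
            using \<alpha> by (simp add: power2_eq_square field_simps)
          finally show ?thesis by simp
        qed
        also have "(norm ?w)\<^sup>2 / \<alpha> \<le> \<alpha> * (norm x)\<^sup>2 - (norm (R *v x))\<^sup>2"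
          using w \<alpha> by (simp add: divide_le_eq mult.commute)
        finally have 1: "2 * t * ((R *v x) \<bullet> (G *v ?w)) \<le>
            \<alpha> * (norm x)\<^sup>2 - (norm (R *v x))\<^sup>2 + \<alpha> * (t * k * norm x)\<^sup>2" by simp
        have "(norm (G *v ?w))\<^sup>2 \<le> g\<^sup>2 * (norm ?w)\<^sup>2" by (rule sq_le_of_bound[OF g(2)])
        also have "\<dots> \<le> g\<^sup>2 * (\<alpha>\<^sup>2 * (norm x)\<^sup>2)" using w2 by (rule mult_left_mono) simp
        finally have 2: "t\<^sup>2 * (norm (G *v ?w))\<^sup>2 \<le> t\<^sup>2 * (g\<^sup>2 * (\<alpha>\<^sup>2 * (norm x)\<^sup>2))"
          by (rule mult_left_mono) simp
        have "?Y *v x = R *v x + t *\<^sub>R (G *v ?w)"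
          by (simp only: D matrix_vector_mult_add_rdistrib scaleR_matrix_vector_assoc[symmetric])
        then have "(norm (?Y *v x))\<^sup>2 =
            (norm (R *v x))\<^sup>2 + 2 * t * ((R *v x) \<bullet> (G *v ?w)) + t\<^sup>2 * (norm (G *v ?w))\<^sup>2"
          by (simp add: norm_add_sq power_mult_distrib)
        also have "\<dots> \<le> \<alpha> * (norm x)\<^sup>2 + \<alpha> * (t * k * norm x)\<^sup>2 + t\<^sup>2 * (g\<^sup>2 * (\<alpha>\<^sup>2 * (norm x)\<^sup>2))"
          using 1 2 by linarith
        also have "\<dots> = (\<alpha> + ?c * t\<^sup>2) * (norm x)\<^sup>2"
          by (simp add: algebra_simps power_mult_distrib)
        finally show ?thesis .
      qed
      then show "(norm (u v* ?Y))\<^sup>2 \<le> (\<alpha> + ?c * t\<^sup>2) * (norm u)\<^sup>2"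
        using sq_le_transpose[of "\<alpha> + ?c * t\<^sup>2" "transpose ?Y" u] \<alpha> c by simp
    qed
  qed
  have self: "G \<bullet> D H = D G \<bullet> H" for G H
    using inner_matrix_mult_right[of H "transpose R ** R" G]
    by (simp add: D_def inner_diff_left inner_diff_right matrix_transpose_mul inner_commute)
  have "D \<Theta> \<bullet> D \<Theta> \<le> 0" using neg[of "D \<Theta>"] by (simp add: self)
  then have "D \<Theta> = 0" by (metis inner_ge_zero inner_eq_zero_iff order_antisym)
  then show ?thesis by (simp add: D_def matrix_mul_assoc)
qed

text \<open>
  The inner product of \<open>\<Theta> R\<^sup>T\<close> with \<open>S S\<^sup>T\<close>, for \<open>S\<close> in the ball, is largest at \<open>S = R\<close>. The reason is
  that \<open>S S\<^sup>T R / \<alpha>\<close> again lies in the ball, where \<open>\<Theta>\<close> attains its maximum at \<open>R\<close>.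
\<close>

lemma normal_cone_Omega2_trace_max:
  assumes \<alpha>: "0 < \<alpha>" and \<Theta>: "\<Theta> \<in> normal_cone (Omega2 \<alpha>) R" and S: "S \<in> Omega2 \<alpha>"
  shows "(\<Theta> ** transpose R ** S) \<bullet> S \<le> (\<Theta> ** transpose R ** R) \<bullet> R"
proof -
  have R: "R \<in> Omega2 \<alpha>" using \<Theta> by (simp add: normal_cone_def)
  let ?Y = "(1 / \<alpha>) *\<^sub>R (S ** transpose S ** R)"
  have "?Y \<in> Omega2 \<alpha>"
    unfolding Omega2_iff[OF \<alpha>]
  proof
    fix x
    let ?v = "(R *v x) v* S"
    have "(norm (S *v ?v))\<^sup>2 \<le> \<alpha> * (norm ?v)\<^sup>2" using S Omega2_iff[OF \<alpha>] by blast
    also have "\<dots> \<le> \<alpha> * (\<alpha> * (norm (R *v x))\<^sup>2)"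
      using S Omega2_iff_left[OF \<alpha>] \<alpha> by (intro mult_left_mono) auto
    also have "\<dots> \<le> \<alpha> * (\<alpha> * (\<alpha> * (norm x)\<^sup>2))"
      using R Omega2_iff[OF \<alpha>] \<alpha> by (intro mult_left_mono) auto
    finally have "(norm (S *v ?v))\<^sup>2 / \<alpha>\<^sup>2 \<le> \<alpha> * (norm x)\<^sup>2"
      using \<alpha> by (simp add: pos_divide_le_eq power2_eq_square ac_simps)
    moreover have "?Y *v x = (1 / \<alpha>) *\<^sub>R (S *v ?v)"
      by (simp add: scaleR_matrix_vector_assoc[symmetric] flip: matrix_vector_mul_assoc)
    ultimately show "(norm (?Y *v x))\<^sup>2 \<le> \<alpha> * (norm x)\<^sup>2"
      by (simp add: power_divide)
  qed
  then have "\<Theta> \<bullet> ?Y \<le> \<Theta> \<bullet> R"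
    using \<Theta> by (auto simp: normal_cone_def inner_diff_right)
  then have "\<Theta> \<bullet> (S ** transpose S ** R) \<le> \<alpha> * (\<Theta> \<bullet> R)"
    using \<alpha> by (simp add: pos_divide_le_eq mult.commute)
  also have "\<dots> = (\<Theta> ** transpose R ** R) \<bullet> R"
    by (simp add: normal_cone_Omega2_complementary[OF \<alpha> \<Theta>])
  also have "\<Theta> \<bullet> (S ** transpose S ** R) = (\<Theta> ** transpose R ** S) \<bullet> S"
    using inner_matrix_mult_right[of "S ** transpose S" R \<Theta>]
      inner_matrix_mult_right[of "\<Theta> ** transpose R" S S] by (simp add: inner_commute)
  finally show ?thesis .
qed

section \<open>Second order tangents along a kernel direction\<close>

lemma svd_apply:
  fixes R :: "real^'r^'n"
  assumes svd: "is_svd R u v \<sigma>"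
  defines "p \<equiv> min CARD('n) CARD('r)"
  shows "i < p \<Longrightarrow> u i v* R = \<sigma> i *\<^sub>R v i"
    and "i < p \<Longrightarrow> R *v v i = \<sigma> i *\<^sub>R u i"
    and "(\<And>i. i < p \<Longrightarrow> u i \<bullet> x = 0) \<Longrightarrow> x v* R = 0"
proof -
  have u: "u i \<bullet> u j = (if i = j then 1 else 0)" and v: "v i \<bullet> v j = (if i = j then 1 else 0)"
    if "i < p" "j < p" for i j
    using svd that by (auto simp: is_svd_def Let_def p_def)
  have R: "R = (\<Sum>i<p. \<sigma> i *\<^sub>R outer (u i) (v i))"
    using svd by (auto simp: is_svd_def Let_def p_def)
  have l: "x v* R = (\<Sum>i<p. (\<sigma> i * (u i \<bullet> x)) *\<^sub>R v i)" for x
    unfolding R linear_sum[OF linear_vec_mult_right]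
    by (simp add: vector_scaleR_matrix_ac vec_mult_outer)
  have r: "R *v x = (\<Sum>i<p. (\<sigma> i * (v i \<bullet> x)) *\<^sub>R u i)" for x
  proof -
    have lin: "linear (\<lambda>Y. (Y :: real^'r^'n) *v x)"
      by (rule linearI) (simp_all add: matrix_vector_mult_add_rdistrib scaleR_matrix_vector_assoc)
    show ?thesis
      unfolding R linear_sum[OF lin] by (simp add: outer_mult_vec scaleR_matrix_vector_assoc[symmetric])
  qed
  have "(\<sigma> j * (u j \<bullet> u i)) *\<^sub>R v j = (if j = i then \<sigma> i *\<^sub>R v i else 0)"
    "(\<sigma> j * (v j \<bullet> v i)) *\<^sub>R u j = (if j = i then \<sigma> i *\<^sub>R u i else 0)" if "i < p" "j < p" for i j
    using that u v by auto
  then show "u i v* R = \<sigma> i *\<^sub>R v i" "R *v v i = \<sigma> i *\<^sub>R u i" if "i < p" for i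
    using that by (simp_all add: l r)
  show "x v* R = 0" if "\<And>i. i < p \<Longrightarrow> u i \<bullet> x = 0"
    using that by (simp add: l)
qed

text \<open>
  Membership in \<open>Gamma_space\<close> says that the quadratic form of \<open>R H\<^sup>T + H R\<^sup>T\<close> vanishes on the span of
  the top left singular vectors, which is the kernel of \<open>L = \<alpha> I - R R\<^sup>T\<close>. Hence the form is bounded
  by a multiple of \<open>norm x * norm (L x)\<close>, and the gap absorbs it up to an error quadratic in \<open>s\<close>.
  So \<open>R + s *\<^sub>R H\<close> leaves the ball only at second order, for \<open>s\<close> of either sign.
\<close>

lemma Gamma_space_estimate:
  fixes R :: "real^'r^'n"
  assumes \<alpha>: "0 < \<alpha>" and R: "R \<in> Omega2 \<alpha>" and svd: "is_svd R u v \<sigma>"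
    and H: "H \<in> Gamma_space \<alpha> u v \<sigma>"
  obtains c where "0 \<le> c" "\<And>s x. 2 * s * ((x v* R) \<bullet> (x v* H)) \<le>
    (\<alpha> * (norm x)\<^sup>2 - (norm (x v* R))\<^sup>2) / 2 + c * s\<^sup>2 * (norm x)\<^sup>2"
proof -
  define p where "p = min CARD('n) CARD('r)"
  define I where "I = {i. i < p \<and> \<sigma> i = sqrt \<alpha>}"
  have I: "finite I" and Ip: "\<And>i. i \<in> I \<Longrightarrow> i < p \<and> \<sigma> i = sqrt \<alpha>" by (auto simp: I_def)
  have u: "u i \<bullet> u j = (if i = j then 1 else 0)" if "i < p" "j < p" for i j
    using svd that by (auto simp: is_svd_def Let_def p_def)
  have \<sigma>: "0 \<le> \<sigma> i" if "i < p" for i using svd that by (auto simp: is_svd_def Let_def p_def)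
  have uR: "u i v* R = \<sigma> i *\<^sub>R v i" and vR: "R *v v i = \<sigma> i *\<^sub>R u i" if "i < p" for i
    using svd_apply(1,2)[OF svd] that by (simp_all add: p_def)
  have H0: "v i \<bullet> (u j v* H) + v j \<bullet> (u i v* H) = 0" if "i \<in> I" "j \<in> I" for i j
    using H that by (simp add: Gamma_space_def Let_def I_def p_def flip: dot_lmul_matrix)
      (simp add: inner_commute)
  \<comment> \<open>\<open>L\<close> is injective on the orthogonal complement of its kernel, the span of the \<open>u i\<close>
      with \<open>i \<in> I\<close>, and hence bounded below there\<close>
  define L where "L x = \<alpha> *\<^sub>R x - R *v (x v* R)" for x
  have linL: "linear L"
    unfolding L_def by (rule linearI)
      (simp_all add: algebra_simps vector_matrix_left_distrib scaleR_vector_matrix_assoc)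
  have uL: "u i \<bullet> L x = (\<alpha> - (\<sigma> i)\<^sup>2) * (u i \<bullet> x)" if "i < p" for i x
  proof -
    have "u i \<bullet> (R *v (x v* R)) = \<sigma> i * (v i \<bullet> (x v* R))"
      using that by (simp add: uR flip: dot_lmul_matrix)
    also have "v i \<bullet> (x v* R) = \<sigma> i * (u i \<bullet> x)"
      using that by (simp add: dot_lmul_matrix vR inner_commute[of "v i"] inner_commute[of x])
    finally show ?thesis by (simp add: L_def inner_diff_right left_diff_distrib power2_eq_square)
  qed
  have Lu: "L (u i) = 0" if "i \<in> I" for i
    using Ip[OF that] \<alpha> by (simp add: L_def uR vR matrix_vector_mult_scaleR)
  define S where "S = {x. \<forall>i\<in>I. u i \<bullet> x = 0}"
  have S: "subspace S" by (auto simp: S_def subspace_def inner_add_right)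
  have "\<exists>e>0. \<forall>x\<in>S. e * norm x \<le> norm (L x)"
  proof (rule injective_imp_isometric)
    show "closed S" using S by (rule closed_subspace)
    show "bounded_linear L" using linL by (simp add: linear_conv_bounded_linear)
    show "\<forall>x\<in>S. L x = 0 \<longrightarrow> x = 0"
    proof (intro ballI impI)
      fix x assume x: "x \<in> S" "L x = 0"
      have "u i \<bullet> x = 0" if "i < p" for i
      proof (cases "i \<in> I")
        case False
        then have "(\<sigma> i)\<^sup>2 \<noteq> \<alpha>" using that \<sigma>[OF that] by (auto simp: I_def)
        then show ?thesis using uL[OF that, of x] x by simp
      qed (use x in \<open>auto simp: S_def\<close>)
      then have "x v* R = 0" using svd_apply(3)[OF svd] by (simp add: p_def)
      with x(2) \<alpha> show "x = 0" by (simp add: L_def)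
    qed
  qed (rule S)
  then obtain e where e: "0 < e" "\<And>x. x \<in> S \<Longrightarrow> e * norm x \<le> norm (L x)" by blast
  define K where "K x = R *v (x v* H)" for x
  have linK: "linear K"
    unfolding K_def by (rule linearI)
      (simp_all add: algebra_simps vector_matrix_left_distrib scaleR_vector_matrix_assoc)
  obtain k where k: "0 < k" "\<And>x. norm (K x) \<le> k * norm x"
    using linear_bounded_pos[OF linK] by blast
  have bound: "\<bar>x \<bullet> K x\<bar> \<le> 3 * k / e * norm x * norm (L x)" for x
  proof -
    define x1 where "x1 = (\<Sum>i\<in>I. (u i \<bullet> x) *\<^sub>R u i)"
    define x2 where "x2 = x - x1"
    have ux1: "u i \<bullet> x1 = u i \<bullet> x" if "i \<in> I" for i
    proof -
      have "(u j \<bullet> x) * (u i \<bullet> u j) = (if j = i then u i \<bullet> x else 0)" if "j \<in> I" for j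
        using u[of i j] Ip[OF that] Ip[OF \<open>i \<in> I\<close>] by auto
      then show ?thesis using I that by (simp add: x1_def inner_sum_right)
    qed
    then have x2S: "x2 \<in> S" by (simp add: S_def x2_def inner_diff_right)
    have "L x1 = 0"
      unfolding x1_def linear_sum[OF linL] by (simp add: linear_scale[OF linL] Lu)
    then have Lx: "L x = L x2" by (simp add: x2_def linear_diff[OF linL])
    have xx: "x1 + x2 = x" by (simp add: x2_def)
    have "x1 \<bullet> x2 = 0"
      unfolding x1_def inner_sum_left using x2S by (simp add: S_def)
    then have "(norm x)\<^sup>2 = (norm x1)\<^sup>2 + (norm x2)\<^sup>2"
      using norm_add_sq[of x1 x2] xx by simp
    then have x2x: "norm x2 \<le> norm x" by (simp add: power2_le_imp_le)
    \<comment> \<open>the coefficients of the form on the span of the \<open>u i\<close> are antisymmetric in \<open>i\<close> and \<open>j\<close>\<close>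
    have "x1 \<bullet> K x1 = (x1 v* R) \<bullet> (x1 v* H)" by (simp add: K_def dot_lmul_matrix)
    also have "\<dots> = (\<Sum>i\<in>I. \<Sum>j\<in>I. sqrt \<alpha> * (u i \<bullet> x) * (u j \<bullet> x) * (v j \<bullet> (u i v* H)))"
      unfolding x1_def linear_sum[OF linear_vec_mult_left] inner_sum_left inner_sum_right
      by (intro sum.cong refl) (simp add: scaleR_vector_matrix_assoc uR Ip)
    also have "\<dots> = 0"
    proof -
      let ?T = "\<lambda>i j. sqrt \<alpha> * (u i \<bullet> x) * (u j \<bullet> x) * (v j \<bullet> (u i v* H))"
      have "(\<Sum>i\<in>I. \<Sum>j\<in>I. ?T i j) = (\<Sum>i\<in>I. \<Sum>j\<in>I. ?T j i)" by (rule sum.swap)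
      also have "\<dots> = (\<Sum>i\<in>I. \<Sum>j\<in>I. - ?T i j)"
      proof (intro sum.cong refl)
        fix i j assume "i \<in> I" "j \<in> I"
        then have "v i \<bullet> (u j v* H) = - (v j \<bullet> (u i v* H))" using H0[of i j] by simp
        then show "?T j i = - ?T i j" by simp
      qed
      finally show ?thesis by (simp add: sum_negf)
    qed
    finally have "x \<bullet> K x = x \<bullet> K x2 + x2 \<bullet> K x - x2 \<bullet> K x2"
      by (simp add: x2_def linear_diff[OF linK] inner_diff_left inner_diff_right)
    moreover have "\<bar>x \<bullet> K x2\<bar> \<le> norm x * (k * norm x2)"
      by (rule order_trans[OF Cauchy_Schwarz_ineq2 mult_left_mono[OF k(2)]]) simp
    moreover have "\<bar>x2 \<bullet> K x\<bar> \<le> norm x2 * (k * norm x)"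
      by (rule order_trans[OF Cauchy_Schwarz_ineq2 mult_left_mono[OF k(2)]]) simp
    moreover have "\<bar>x2 \<bullet> K x2\<bar> \<le> norm x2 * (k * norm x2)"
      by (rule order_trans[OF Cauchy_Schwarz_ineq2 mult_left_mono[OF k(2)]]) simp
    moreover have "norm x2 * (k * norm x2) \<le> norm x2 * (k * norm x)"
      using x2x k by (intro mult_left_mono) auto
    ultimately have "\<bar>x \<bullet> K x\<bar> \<le> 3 * k * norm x * norm x2" by (simp add: ac_simps)
    also have "norm x2 \<le> norm (L x) / e" using e(2)[OF x2S] e(1) by (simp add: Lx field_simps)
    then have "3 * k * norm x * norm x2 \<le> 3 * k * norm x * (norm (L x) / e)"
      using k by (intro mult_left_mono) auto
    finally show ?thesis by simp
  qed
  let ?k = "3 * k / e"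
  show ?thesis
  proof
    show "0 \<le> 2 * \<alpha> * ?k\<^sup>2" using \<alpha> by simp
    fix s x
    have "2 * s * ((x v* R) \<bullet> (x v* H)) = 2 * s * (x \<bullet> K x)" by (simp add: K_def dot_lmul_matrix)
    also have "\<dots> \<le> 2 * (\<bar>s\<bar> * \<bar>x \<bullet> K x\<bar>)" by (metis abs_ge_self abs_mult mult.assoc mult_left_mono zero_le_numeral)
    also have "\<dots> \<le> 2 * (\<bar>s\<bar> * (?k * norm x * norm (L x)))"
      using bound[of x] by (intro mult_left_mono) auto
    also have "\<dots> \<le> (norm (L x))\<^sup>2 / (2 * \<alpha>) + 2 * \<alpha> * (\<bar>s\<bar> * ?k * norm x)\<^sup>2"
    proof -
      have "0 \<le> (norm (L x) - 2 * \<alpha> * (\<bar>s\<bar> * ?k * norm x))\<^sup>2 / (2 * \<alpha>)" using \<alpha> by simp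
      also have "\<dots> = (norm (L x))\<^sup>2 / (2 * \<alpha>) + 2 * \<alpha> * (\<bar>s\<bar> * ?k * norm x)\<^sup>2
          - 2 * (\<bar>s\<bar> * (?k * norm x * norm (L x)))"
        using \<alpha> e by (simp add: power2_diff add_divide_distrib diff_divide_distrib)
          (simp add: power2_eq_square ac_simps)
      finally show ?thesis by simp
    qed
    also have "(norm (L x))\<^sup>2 / (2 * \<alpha>) \<le> (\<alpha> * (norm x)\<^sup>2 - (norm (x v* R))\<^sup>2) / 2"
      using spectral_gap_bound[OF \<alpha>, of R x] Omega2_iff[OF \<alpha>, of R] R \<alpha>
      by (simp add: L_def divide_le_eq ac_simps)
    finally show "2 * s * ((x v* R) \<bullet> (x v* H)) \<le>
        (\<alpha> * (norm x)\<^sup>2 - (norm (x v* R))\<^sup>2) / 2 + 2 * \<alpha> * ?k\<^sup>2 * s\<^sup>2 * (norm x)\<^sup>2"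
      by (simp add: power_mult_distrib power_divide ac_simps)
  qed
qed

text \<open>
  For \<open>R *v x = 0\<close> the first order term \<open>t *\<^sub>R outer h x\<close> adds \<open>t\<^sup>2 h h\<^sup>T\<close> to \<open>R R\<^sup>T\<close>. On the top
  singular space this must be compensated at second order; the correction \<open>- (h h\<^sup>T R) / \<alpha>\<close> does so,
  since it changes \<open>R R\<^sup>T\<close> by \<open>- t\<^sup>2 / (2 * \<alpha>)\<close> times \<open>h h\<^sup>T R R\<^sup>T + R R\<^sup>T h h\<^sup>T\<close>, and \<open>R R\<^sup>T\<close> acts as
  \<open>\<alpha>\<close> there. What remains is linear in \<open>(\<alpha> I - R R\<^sup>T) *v y\<close> and uses half of the gap; \<open>H\<close> uses
  the other half. The rest is cubic in \<open>t\<close>.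
\<close>

lemma second_order_curve:
  fixes R H :: "real^'r^'n"
  assumes \<alpha>: "0 < \<alpha>" and R: "R \<in> Omega2 \<alpha>" and x: "R *v x = 0" "norm x = 1" and c0: "0 \<le> c0"
    and H: "\<And>s y. 2 * s * ((y v* R) \<bullet> (y v* H)) \<le>
      (\<alpha> * (norm y)\<^sup>2 - (norm (y v* R))\<^sup>2) / 2 + c0 * s\<^sup>2 * (norm y)\<^sup>2"
  obtains c where "0 \<le> c"
    "\<And>t y. 0 < t \<Longrightarrow> t \<le> 1 \<Longrightarrow>
      (norm (y v* (R + t *\<^sub>R outer h x
        + (t\<^sup>2 / 2) *\<^sub>R (H - (1 / \<alpha>) *\<^sub>R outer h (h v* R)))))\<^sup>2 \<le> (\<alpha> + c * t^3) * (norm y)\<^sup>2"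
proof -
  define W where "W = H - (1 / \<alpha>) *\<^sub>R outer h (h v* R)"
  obtain e where e: "0 \<le> e" "\<And>y. norm (y v* W) \<le> e * norm y"
    using norm_matvec_bound[of W] by metis
  let ?c = "e\<^sup>2 / 4 + norm h * e + c0 / 4 + (norm h)^4 / (2 * \<alpha>)"
  show ?thesis
  proof
    show c: "0 \<le> ?c" using \<alpha> e c0 by (intro add_nonneg_nonneg) auto
    fix t :: real and y assume t: "0 < t" "t \<le> 1"
    define a where "a = y v* R"
    define k where "k = h \<bullet> y"
    define E where "E = y v* W"
    define l where "l = \<alpha> *\<^sub>R y - R *v a"
    have E: "E = y v* H - (k / \<alpha>) *\<^sub>R (h v* R)"
      by (simp add: E_def W_def k_def vector_matrix_mult_diff_rdistrib vector_scaleR_matrix_ac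
          vec_mult_outer)
    have ax: "a \<bullet> x = 0" by (simp add: a_def dot_lmul_matrix x)
    have kle: "\<bar>k\<bar> \<le> norm h * norm y" unfolding k_def by (rule Cauchy_Schwarz_ineq2)
    have Ele: "norm E \<le> e * norm y" unfolding E_def by (rule e)
    have l: "(norm l)\<^sup>2 / (2 * \<alpha>) \<le> (\<alpha> * (norm y)\<^sup>2 - (norm a)\<^sup>2) / 2"
      using spectral_gap_bound[OF \<alpha>, of R y] Omega2_iff[OF \<alpha>, of R] R \<alpha>
      by (simp add: l_def a_def divide_le_eq ac_simps)
    have "y v* (R + t *\<^sub>R outer h x + (t\<^sup>2 / 2) *\<^sub>R W) = a + ((t * k) *\<^sub>R x + (t\<^sup>2 / 2) *\<^sub>R E)"
      by (simp add: a_def k_def E_def vector_matrix_mult_add_rdistrib vector_scaleR_matrix_ac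
          vec_mult_outer)
    then have "(norm (y v* (R + t *\<^sub>R outer h x + (t\<^sup>2 / 2) *\<^sub>R W)))\<^sup>2 =
        (norm a)\<^sup>2 + t\<^sup>2 * (a \<bullet> E) + t\<^sup>2 * k\<^sup>2 + t^3 * (k * (x \<bullet> E)) + t^4 / 4 * (norm E)\<^sup>2"
      using x by (simp add: norm_add_sq ax inner_add_right power_mult_distrib power_divide)
        (simp add: power_numeral_reduce)
    also have "t\<^sup>2 * (a \<bullet> E) = 2 * (t\<^sup>2 / 2) * (a \<bullet> (y v* H)) - t\<^sup>2 * (k / \<alpha> * (h \<bullet> (R *v a)))"
    proof -
      have "a \<bullet> (h v* R) = h \<bullet> (R *v a)" by (metis dot_lmul_matrix inner_commute)
      then show ?thesis by (simp add: E inner_diff_right algebra_simps)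
    qed
    finally have eq: "(norm (y v* (R + t *\<^sub>R outer h x + (t\<^sup>2 / 2) *\<^sub>R W)))\<^sup>2 =
        (norm a)\<^sup>2 + 2 * (t\<^sup>2 / 2) * (a \<bullet> (y v* H)) + t\<^sup>2 * (k / \<alpha> * (h \<bullet> l))
        + t^3 * (k * (x \<bullet> E)) + t^4 / 4 * (norm E)\<^sup>2"
      using \<alpha> by (simp add: l_def inner_diff_right k_def field_simps power2_eq_square)
    have 1: "2 * (t\<^sup>2 / 2) * (a \<bullet> (y v* H)) \<le>
        (\<alpha> * (norm y)\<^sup>2 - (norm a)\<^sup>2) / 2 + t^3 * (c0 / 4 * (norm y)\<^sup>2)"
    proof -
      have "t^4 \<le> t^3" using t by (intro power_decreasing) auto
      then have "t^4 * (c0 / 4 * (norm y)\<^sup>2) \<le> t^3 * (c0 / 4 * (norm y)\<^sup>2)"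
        using c0 by (intro mult_right_mono) auto
      moreover have "c0 * (t\<^sup>2 / 2)\<^sup>2 * (norm y)\<^sup>2 = t^4 * (c0 / 4 * (norm y)\<^sup>2)"
        by (simp add: power_divide)
      ultimately show ?thesis using H[where s="t\<^sup>2 / 2" and y=y] unfolding a_def by linarith
    qed
    have 2: "t\<^sup>2 * (k / \<alpha> * (h \<bullet> l)) \<le>
        (\<alpha> * (norm y)\<^sup>2 - (norm a)\<^sup>2) / 2 + t^3 * ((norm h)^4 / (2 * \<alpha>) * (norm y)\<^sup>2)"
    proof -
      have "k * (h \<bullet> l) \<le> \<bar>k\<bar> * \<bar>h \<bullet> l\<bar>" by (metis abs_ge_self abs_mult)
      also have "\<dots> \<le> (norm h * norm y) * (norm h * norm l)"
        by (intro mult_mono kle Cauchy_Schwarz_ineq2) auto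
      finally have "t\<^sup>2 / \<alpha> * (k * (h \<bullet> l)) \<le> t\<^sup>2 / \<alpha> * ((norm h * norm y) * (norm h * norm l))"
        using \<alpha> by (intro mult_left_mono) auto
      also have "\<dots> \<le> (norm l)\<^sup>2 / (2 * \<alpha>) + (t\<^sup>2 * (norm h)\<^sup>2 * norm y)\<^sup>2 / (2 * \<alpha>)"
      proof -
        have "0 \<le> (norm l - t\<^sup>2 * (norm h)\<^sup>2 * norm y)\<^sup>2 / (2 * \<alpha>)" using \<alpha> by simp
        also have "\<dots> = (norm l)\<^sup>2 / (2 * \<alpha>) + (t\<^sup>2 * (norm h)\<^sup>2 * norm y)\<^sup>2 / (2 * \<alpha>)
            - t\<^sup>2 / \<alpha> * ((norm h * norm y) * (norm h * norm l))"
          using \<alpha> by (simp add: power2_diff add_divide_distrib diff_divide_distrib)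
            (simp add: power2_eq_square)
        finally show ?thesis by simp
      qed
      also have "(t\<^sup>2 * (norm h)\<^sup>2 * norm y)\<^sup>2 / (2 * \<alpha>) = t^4 * ((norm h)^4 / (2 * \<alpha>) * (norm y)\<^sup>2)"
        by (simp add: power_mult_distrib)
      also have "\<dots> \<le> t^3 * ((norm h)^4 / (2 * \<alpha>) * (norm y)\<^sup>2)"
        using t \<alpha> by (intro mult_right_mono power_decreasing) auto
      finally have "t\<^sup>2 / \<alpha> * (k * (h \<bullet> l)) \<le>
          (norm l)\<^sup>2 / (2 * \<alpha>) + t^3 * ((norm h)^4 / (2 * \<alpha>) * (norm y)\<^sup>2)" by simp
      moreover have "t\<^sup>2 * (k / \<alpha> * (h \<bullet> l)) = t\<^sup>2 / \<alpha> * (k * (h \<bullet> l))" by simp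
      ultimately show ?thesis using l by linarith
    qed
    have 3: "t^3 * (k * (x \<bullet> E)) \<le> t^3 * (norm h * e * (norm y)\<^sup>2)"
    proof -
      have "k * (x \<bullet> E) \<le> \<bar>k\<bar> * \<bar>x \<bullet> E\<bar>" by (metis abs_ge_self abs_mult)
      also have "\<dots> \<le> (norm h * norm y) * (e * norm y)"
        using Cauchy_Schwarz_ineq2[of x E] Ele x by (intro mult_mono kle) auto
      finally show ?thesis using t by (intro mult_left_mono) (auto simp: power2_eq_square ac_simps)
    qed
    have 4: "t^4 / 4 * (norm E)\<^sup>2 \<le> t^3 * (e\<^sup>2 / 4 * (norm y)\<^sup>2)"
    proof -
      have "t^4 / 4 * (norm E)\<^sup>2 \<le> t^3 / 4 * (e\<^sup>2 * (norm y)\<^sup>2)"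
        using t by (intro mult_mono sq_le_of_bound Ele divide_right_mono power_decreasing) auto
      then show ?thesis by simp
    qed
    show "(norm (y v* (R + t *\<^sub>R outer h x
        + (t\<^sup>2 / 2) *\<^sub>R (H - (1 / \<alpha>) *\<^sub>R outer h (h v* R)))))\<^sup>2 \<le> (\<alpha> + ?c * t^3) * (norm y)\<^sup>2"
    proof -
      have "(\<alpha> + ?c * t^3) * (norm y)\<^sup>2 = \<alpha> * (norm y)\<^sup>2 + t^3 * (e\<^sup>2 / 4 * (norm y)\<^sup>2)
          + t^3 * (norm h * e * (norm y)\<^sup>2) + t^3 * (c0 / 4 * (norm y)\<^sup>2)
          + t^3 * ((norm h)^4 / (2 * \<alpha>) * (norm y)\<^sup>2)"
        by (simp add: distrib_right distrib_left ac_simps)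
      moreover have "X \<le> Z" if "X = A + B + C + D + F" "B \<le> (N - A) / 2 + b'" "C \<le> (N - A) / 2 + c'"
        "D \<le> d'" "F \<le> f'" "Z = N + f' + d' + b' + c'" for A B C D F N X Z b' c' d' f' :: real
        using that by argo
      ultimately show ?thesis using eq 1 2 3 4 unfolding W_def[symmetric] by blast
    qed
  qed
qed

lemma infdist_Kset_le:
  assumes "Z \<in> Omega2 \<alpha>"
  shows "infdist (0, 0, Y) (Kset \<alpha> :: ((real^'k) \<times> (real^'r) \<times> (real^'r^'n)) set) \<le> norm (Y - Z)"
proof -
  have "infdist (0, 0, Y) (Kset \<alpha> :: ((real^'k) \<times> (real^'r) \<times> (real^'r^'n)) set)
      \<le> dist (0 :: real^'k, 0 :: real^'r, Y) (0, 0, Z)"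
    by (rule infdist_le) (simp add: Kset_def assms)
  then show ?thesis by (simp add: dist_Pair_Pair dist_norm)
qed

text \<open>
  The next two lemmas turn norm estimates into tangency: a curve whose squared norm exceeds \<open>\<alpha>\<close> by
  \<open>c * t ^ p\<close> has distance of order \<open>t ^ p\<close> from the ball, which is \<open>o(t\<^sup>2)\<close> for \<open>p = 3\<close> and \<open>o(t)\<close>
  for \<open>p = 2\<close>.
\<close>

lemma inner_tangent2_Kset:
  fixes R d w :: "real^'r^'n"
  assumes \<alpha>: "0 < \<alpha>" and c: "0 \<le> c"
    and curve: "\<And>t y. 0 < t \<Longrightarrow> t \<le> 1 \<Longrightarrow>
      (norm (y v* (R + t *\<^sub>R d + (t\<^sup>2 / 2) *\<^sub>R w)))\<^sup>2 \<le> (\<alpha> + c * t^3) * (norm y)\<^sup>2"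
  shows "(0, 0, w) \<in> inner_tangent2 (Kset \<alpha> :: ((real^'k) \<times> (real^'r) \<times> (real^'r^'n)) set) (0, 0, R) (0, 0, d)"
proof -
  let ?Y = "\<lambda>t. R + t *\<^sub>R d + (t\<^sup>2 / 2) *\<^sub>R w"
  let ?f = "\<lambda>t. infdist ((0, 0, R) + t *\<^sub>R (0, 0, d) + (t\<^sup>2 / 2) *\<^sub>R (0, 0, w))
      (Kset \<alpha> :: ((real^'k) \<times> (real^'r) \<times> (real^'r^'n)) set)"
  let ?M = "norm R + norm d + norm w"
  let ?C = "c / \<alpha> * ?M"
  have le: "?f t \<le> ?C * t^3" if t: "0 < t" "t \<le> 1" for t
  proof -
    have "0 \<le> c * t^3" using c t by simp
    then obtain Z where Z: "Z \<in> Omega2 \<alpha>" "norm (?Y t - Z) \<le> (c * t^3 / \<alpha>) * norm (?Y t)"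
      using Omega2_nearby[OF \<alpha>, of "c * t^3" "?Y t"] curve[OF t] by blast
    have "norm (?Y t) \<le> norm R + t * norm d + t\<^sup>2 / 2 * norm w"
      using t by (intro norm_triangle_le add_mono) auto
    also have "\<dots> \<le> norm R + 1 * norm d + 1 * norm w"
    proof -
      have "t\<^sup>2 \<le> 1" using t by (simp add: power_le_one)
      then show ?thesis using t by (intro add_mono mult_right_mono) auto
    qed
    finally have "(c * t^3 / \<alpha>) * norm (?Y t) \<le> (c * t^3 / \<alpha>) * ?M"
      using c \<alpha> t by (intro mult_left_mono) auto
    then have "norm (?Y t - Z) \<le> ?C * t^3" using Z(2) by (simp add: ac_simps)
    moreover have "?f t \<le> norm (?Y t - Z)"
      using infdist_Kset_le[OF Z(1), of "?Y t"] by (simp add: plus_prod_def)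
    ultimately show ?thesis by simp
  qed
  have "?f \<in> O[at_right 0](\<lambda>t. t^3)"
  proof (rule bigoI)
    show "\<forall>\<^sub>F t in at_right 0. norm (?f t) \<le> ?C * norm (t^3)"
      unfolding eventually_at_right_field
    proof (intro exI[of _ 1] conjI allI impI)
      fix t :: real assume "0 < t" "t < 1"
      then show "norm (?f t) \<le> ?C * norm (t^3)" using le[of t] by (simp add: infdist_nonneg)
    qed simp
  qed
  also have "(\<lambda>t::real. t^3) \<in> o[at_right 0](\<lambda>t. t\<^sup>2)"
  proof (rule smalloI_tendsto)
    have "((\<lambda>t::real. t) \<longlongrightarrow> 0) (at_right 0)" by simp
    moreover have "\<forall>\<^sub>F t::real in at_right 0. t = t^3 / t\<^sup>2"
      unfolding eventually_at_right_field by (intro exI[of _ 1]) (auto simp: power_numeral_reduce)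
    ultimately show "((\<lambda>t::real. t^3 / t\<^sup>2) \<longlongrightarrow> 0) (at_right 0)"
      by (rule Lim_transform_eventually)
    show "\<forall>\<^sub>F t::real in at_right 0. t\<^sup>2 \<noteq> 0"
      unfolding eventually_at_right_field by (intro exI[of _ 1]) auto
  qed
  finally show ?thesis by (simp add: inner_tangent2_def)
qed

lemma tangent_cone_Kset:
  fixes R d :: "real^'r^'n"
  assumes \<alpha>: "0 < \<alpha>" and c: "0 \<le> c"
    and curve: "\<And>t y. 0 < t \<Longrightarrow> t \<le> 1 \<Longrightarrow>
      (norm (y v* (R + t *\<^sub>R d)))\<^sup>2 \<le> (\<alpha> + c * t\<^sup>2) * (norm y)\<^sup>2"
  shows "(0, 0, d) \<in> tangent_cone (Kset \<alpha> :: ((real^'k) \<times> (real^'r) \<times> (real^'r^'n)) set) (0, 0, R)"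
  unfolding tangent_cone_def closure_approachable
proof (intro allI impI)
  let ?K = "Kset \<alpha> :: ((real^'k) \<times> (real^'r) \<times> (real^'r^'n)) set"
  fix \<epsilon> :: real assume \<epsilon>: "0 < \<epsilon>"
  let ?C = "c / \<alpha> * (norm R + norm d)"
  have C: "0 \<le> ?C" using c \<alpha> by simp
  define t where "t = min 1 (\<epsilon> / (2 * (?C + 1)))"
  have t: "0 < t" "t \<le> 1" using \<epsilon> C by (auto simp: t_def)
  let ?Y = "R + t *\<^sub>R d"
  have "0 \<le> c * t\<^sup>2" using c by simp
  then obtain Z where Z: "Z \<in> Omega2 \<alpha>" "norm (?Y - Z) \<le> (c * t\<^sup>2 / \<alpha>) * norm ?Y"
    using Omega2_nearby[OF \<alpha>, of "c * t\<^sup>2" ?Y] curve[OF t] by blast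
  have "norm ?Y \<le> norm R + t * norm d" using t by (intro norm_triangle_le) auto
  also have "\<dots> \<le> norm R + 1 * norm d" using t by (intro add_mono mult_right_mono) auto
  finally have "(c * t\<^sup>2 / \<alpha>) * norm ?Y \<le> (c * t\<^sup>2 / \<alpha>) * (norm R + norm d)"
    using c \<alpha> by (intro mult_left_mono) auto
  then have le: "norm (?Y - Z) \<le> t * (?C * t)" using Z(2) by (simp add: power2_eq_square ac_simps)
  let ?z = "(1 / t) *\<^sub>R ((0, 0, Z) - (0, 0, R)) :: (real^'k) \<times> (real^'r) \<times> (real^'r^'n)"
  show "\<exists>z\<in>cone hull ((\<lambda>y. y - (0, 0, R)) ` ?K). dist z (0, 0, d) < \<epsilon>"
  proof
    have "(0, 0, Z) \<in> ?K" using Z by (simp add: Kset_def)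
    then show "?z \<in> cone hull ((\<lambda>y. y - (0, 0, R)) ` ?K)"
      using t by (intro mem_cone cone_cone_hull hull_inc imageI) auto
    have "norm ((1 / t) *\<^sub>R (Z - R) - d) = norm (?Y - Z) / t"
    proof -
      have "(1 / t) *\<^sub>R (Z - R) - d = - ((1 / t) *\<^sub>R (?Y - Z))"
        using t by (simp add: algebra_simps)
      then show ?thesis using t by simp
    qed
    also have "\<dots> \<le> ?C * t" using le t by (simp add: pos_divide_le_eq mult.commute)
    also have "\<dots> \<le> ?C * (\<epsilon> / (2 * (?C + 1)))" using C by (intro mult_left_mono) (auto simp: t_def)
    also have "\<dots> < \<epsilon>"
    proof -
      have "k * \<epsilon> < \<epsilon> * (2 * (k + 1))" if "0 \<le> k" for k
        using mult_nonneg_nonneg[OF that less_imp_le[OF \<epsilon>]] \<epsilon> by (simp add: algebra_simps)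
      moreover have "0 < 2 * (k + 1)" if "0 \<le> k" for k :: real using that by simp
      ultimately have "k * (\<epsilon> / (2 * (k + 1))) < \<epsilon>" if "0 \<le> k" for k
        using that by (simp add: pos_divide_less_eq)
      then show ?thesis using C by blast
    qed
    finally show "dist ?z (0, 0, d) < \<epsilon>" by (simp add: dist_Pair_Pair dist_norm)
  qed
qed

section \<open>The constraint map and a certificate of global optimality\<close>

lemma mat_of_Symm_gram: "mat_of (Symm (R ** transpose R)) = R ** transpose (R :: real^'r^'n)"
  by (rule Symm_inverse) (simp add: matrix_transpose_mul)

lemma mat_of_Symm_polar:
  "mat_of (Symm (R ** transpose H + H ** transpose R)) = R ** transpose H + H ** transpose (R :: real^'r^'n)"
  by (rule Symm_inverse) (simp add: matrix_transpose_mul transpose_add add.commute)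

lemma transpose_mat_of [simp]: "transpose (mat_of X) = mat_of X"
  using mat_of[of X] by simp

lemma mat_of_vec_commute: "x v* mat_of X = mat_of X *v x"
  by (metis transpose_mat_of transpose_matrix_vector)

lemma inner_Symm_gram: "X \<bullet> Symm (R ** transpose R) = (mat_of X ** R) \<bullet> (R :: real^'r^'n)"
  by (simp add: inner_symm.rep_eq mat_of_Symm_gram inner_matrix_mult_right)

lemma inner_Symm_polar:
  "X \<bullet> Symm (R ** transpose H + H ** transpose R) = 2 * ((mat_of X ** R) \<bullet> (H :: real^'r^'n))"
proof -
  have "mat_of X \<bullet> (R ** transpose H) = mat_of X \<bullet> (H ** transpose R)"
    using inner_transpose[of "mat_of X" "R ** transpose H"] by (simp add: matrix_transpose_mul)
  moreover have "(mat_of X ** R) \<bullet> H = mat_of X \<bullet> (H ** transpose R)"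
    by (rule inner_matrix_mult_right)
  ultimately show ?thesis
    by (simp add: inner_symm.rep_eq mat_of_Symm_polar inner_add_right)
qed

lemma psd_gram: "psd (Symm (R ** transpose R))"
  by (simp add: psd_def mat_of_Symm_gram flip: matrix_vector_mul_assoc dot_lmul_matrix)

lemma linear_gmap:
  fixes A :: "'n::finite symm \<Rightarrow> real^'k" and R :: "real^'r^'n"
  assumes "linear A"
  shows "linear (gmap A R)"
proof -
  let ?P = "\<lambda>H. Symm (R ** transpose H + H ** transpose R)"
  have "?P (H + H') = ?P H + ?P H'" "?P (c *\<^sub>R H) = c *\<^sub>R ?P H" for H H' :: "real^'r^'n" and c
    unfolding mat_of_inject[symmetric] plus_symm.rep_eq scaleR_symm.rep_eq mat_of_Symm_polar
    by (simp_all add: transpose_add transpose_scaleR matrix_add_ldistrib matrix_add_rdistrib matrix_scaleR_left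
        matrix_scaleR_right scaleR_add_right)
  then show ?thesis
    by (intro linearI) (simp_all add: gmap_def linear_add[OF assms] linear_scale[OF assms]
        vector_matrix_mult_add_rdistrib vector_scaleR_matrix_ac scaleR_add_right)
qed

lemma adjoint_gmap:
  fixes A :: "'n::finite symm \<Rightarrow> real^'k" and R :: "real^'r^'n"
  assumes "linear A"
  shows "adjoint (gmap A R) (y, z) = mat_of (adjoint A y) ** R + outer ones z"
proof -
  have "adjoint (gmap A R) = (\<lambda>(y, z). mat_of (adjoint A y) ** R + outer ones z)"
  proof (rule adjoint_unique, intro allI)
    fix H :: "real^'r^'n" and w :: "(real^'k) \<times> (real^'r)"
    obtain y z where w: "w = (y, z)" by force
    have "A X \<bullet> y = adjoint A y \<bullet> X" for X
      using adjoint_works[OF assms, of X y] by (simp add: inner_commute)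
    then have "gmap A R H \<bullet> w = (mat_of (adjoint A y) ** R) \<bullet> H + (ones v* H) \<bullet> z"
      by (simp add: gmap_def w inner_Symm_polar)
    also have "(ones v* H) \<bullet> z = outer ones z \<bullet> H" by (simp add: inner_outer dot_lmul_matrix)
    finally show "gmap A R H \<bullet> w = H \<bullet> (case w of (y, z) \<Rightarrow> mat_of (adjoint A y) ** R + outer ones z)"
      by (simp add: w inner_add_left inner_commute[of H])
  qed
  then show ?thesis by simp
qed

lemma bij_compose_adjoint:
  fixes g :: "'a::euclidean_space \<Rightarrow> 'b::euclidean_space"
  assumes g: "linear g" and "surj g"
  shows "bij (g \<circ> adjoint g)"
proof -
  have lin: "linear (g \<circ> adjoint g)" using g by (intro linear_compose adjoint_linear)
  have "inj (g \<circ> adjoint g)"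
    unfolding linear_injective_0[OF lin]
  proof (intro allI impI)
    fix y assume "(g \<circ> adjoint g) y = 0"
    then have "g (adjoint g y) \<bullet> y = 0" by simp
    then have "adjoint g y = 0" by (simp add: adjoint_works[OF g, symmetric])
    then have "g x \<bullet> y = 0" for x by (simp add: adjoint_works[OF g, symmetric])
    then show "y = 0" using \<open>surj g\<close> by (metis inner_eq_zero_iff surjD)
  qed
  then show ?thesis using linear_injective_imp_surjective[OF lin] by (simp add: bij_def)
qed

lemma feasible_iff_Gmap:
  "Gmap A b R \<in> Kset \<alpha> \<longleftrightarrow> R \<in> sdplr1_feasible A b \<alpha>"
  by (simp add: Gmap_def Kset_def sdplr1_feasible_def Omega2_def)

lemma inner_mult_eq_sum_columns:
  fixes M :: "real^'n^'n" and S :: "real^'r^'n"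
  shows "(M ** S) \<bullet> S = (\<Sum>j\<in>UNIV. column j S \<bullet> (M *v column j S))"
proof -
  have "(M ** S) \<bullet> S = (\<Sum>i\<in>UNIV. \<Sum>j\<in>UNIV. (M ** S)$i$j * S$i$j)" by (simp add: inner_vec_def)
  also have "\<dots> = (\<Sum>j\<in>UNIV. \<Sum>i\<in>UNIV. (M ** S)$i$j * S$i$j)" by (rule sum.swap)
  also have "\<dots> = (\<Sum>j\<in>UNIV. column j S \<bullet> (M *v column j S))"
    by (simp add: inner_vec_def column_def matrix_matrix_mult_def matrix_vector_mult_def ac_simps)
  finally show ?thesis .
qed

text \<open>
  This is weak duality for the semidefinite program with the additional constraint
  \<open>X \<le> \<alpha> I\<close>. With \<open>N = \<Theta> R\<^sup>T / \<alpha>\<close>, the slack matrix \<open>C - A\<^sup>* y + N\<close> sends \<open>R\<close> to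
  \<open>outer ones z\<close>, which is orthogonal to \<open>R\<close>, and is positive semidefinite on the complement of
  \<open>ones\<close>, where the columns of feasible matrices lie. Finally, the inner product of \<open>N\<close> with \<open>S S\<^sup>T\<close> is largest
  at \<open>S = R\<close>.
\<close>

lemma global_minimizer_of_certificate:
  fixes A :: "'n::finite symm \<Rightarrow> real^'k" and R \<Theta> :: "real^'r^'n"
  assumes A: "linear A" and \<alpha>: "0 < \<alpha>" and R: "R \<in> sdplr1_feasible A b \<alpha>"
    and \<Theta>: "\<Theta> \<in> normal_cone (Omega2 \<alpha>) R"
    and kkt: "mat_of (C - adjoint A y) ** R - outer ones z = - \<Theta>"
    and curv: "\<And>h. h \<bullet> ones = 0 \<Longrightarrow>
      0 \<le> h \<bullet> (mat_of (C - adjoint A y) *v h) + h \<bullet> ((\<Theta> ** transpose R) *v h) / \<alpha>"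
  shows "sdplr1_global_minimizer A b \<alpha> C R"
  unfolding sdplr1_global_minimizer_def
proof (intro conjI ballI)
  fix S :: "real^'r^'n" assume S: "S \<in> sdplr1_feasible A b \<alpha>"
  define D where "D = mat_of (C - adjoint A y)"
  define N where "N = (1 / \<alpha>) *\<^sub>R (\<Theta> ** transpose R)"
  have split: "2 * sdplr1_objective C T = ((D + N) ** T) \<bullet> T + y \<bullet> b - (N ** T) \<bullet> T"
    if "T \<in> sdplr1_feasible A b \<alpha>" for T :: "real^'r^'n"
  proof -
    have "y \<bullet> b = A (Symm (T ** transpose T)) \<bullet> y"
      using that by (simp add: sdplr1_feasible_def inner_commute)
    also have "\<dots> = adjoint A y \<bullet> Symm (T ** transpose T)"
      using adjoint_works[OF A, of "Symm (T ** transpose T)" y] by (simp add: inner_commute)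
    finally have "C \<bullet> Symm (T ** transpose T) = (C - adjoint A y) \<bullet> Symm (T ** transpose T) + y \<bullet> b"
      by (simp add: inner_diff_left)
    also have "(C - adjoint A y) \<bullet> Symm (T ** transpose T) = (D ** T) \<bullet> T"
      by (simp add: inner_Symm_gram D_def)
    finally show ?thesis
      by (simp add: sdplr1_objective_def matrix_add_rdistrib inner_add_left)
  qed
  have "((D + N) ** R) \<bullet> R = 0"
  proof -
    have "(D + N) ** R = outer ones z"
      using kkt \<alpha> normal_cone_Omega2_complementary[OF \<alpha> \<Theta>]
      by (simp add: matrix_add_rdistrib N_def matrix_scaleR_left flip: D_def)
        (simp add: algebra_simps eq_neg_iff_add_eq_0 diff_eq_eq)
    then show ?thesis
      using R by (simp add: inner_outer sdplr1_feasible_def flip: dot_lmul_matrix)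
  qed
  moreover have "0 \<le> ((D + N) ** S) \<bullet> S"
    unfolding inner_mult_eq_sum_columns
  proof (rule sum_nonneg)
    fix j
    have "column j S \<bullet> ones = (ones v* S) $ j"
      by (simp add: inner_vec_def column_def vector_matrix_mult_def)
    also have "\<dots> = 0" using S by (simp add: sdplr1_feasible_def)
    finally show "0 \<le> column j S \<bullet> ((D + N) *v column j S)"
      using curv[of "column j S"]
      by (simp add: matrix_vector_mult_add_rdistrib inner_add_right N_def flip: D_def
          scaleR_matrix_vector_assoc)
  qed
  moreover have "(N ** S) \<bullet> S \<le> (N ** R) \<bullet> R"
  proof -
    have "S \<in> Omega2 \<alpha>" using S by (simp add: sdplr1_feasible_def Omega2_def)
    from normal_cone_Omega2_trace_max[OF \<alpha> \<Theta> this] show ?thesis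
      using \<alpha> by (simp add: N_def matrix_scaleR_left divide_right_mono)
  qed
  ultimately show "sdplr1_objective C R \<le> sdplr1_objective C S"
    using split[OF R] split[OF S] by linarith
qed (rule R)

text \<open>
  If \<open>R\<close> has a kernel vector \<open>x\<close>, then every \<open>h\<close> orthogonal to \<open>ones\<close> gives a tangent direction
  \<open>d = outer h x\<close> that does not change \<open>R R\<^sup>T\<close> at first order. Regularity provides the
  \<open>H\<close> in \<open>Gamma_space\<close> with which \<open>w = H - outer h (h v* R) / \<alpha>\<close> restores the linear constraints
  at second order. The KKT system turns the second order inequality into the claim about \<open>h\<close>; here
  \<open>h h\<^sup>T R / \<alpha>\<close> contributes exactly the curvature term of the spectral norm ball.
\<close>

lemma curvature_of_second_order:
  fixes A :: "'n::finite symm \<Rightarrow> real^'k" and R \<Theta> :: "real^'r^'n"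
  assumes A: "linear A" and \<alpha>: "0 < \<alpha>"
    and reg: "regular_point A b \<alpha> R" and sos: "second_order_stationary A b \<alpha> C R"
    and \<Theta>: "\<Theta> \<in> normal_cone (Omega2 \<alpha>) R"
    and kkt: "mat_of (C - adjoint A y) ** R - outer ones z = - \<Theta>"
    and x: "R *v x = 0" "norm x = 1" and h: "h \<bullet> ones = 0"
  shows "0 \<le> h \<bullet> (mat_of (C - adjoint A y) *v h) + h \<bullet> ((\<Theta> ** transpose R) *v h) / \<alpha>"
proof -
  have G: "Gmap A b R \<in> Kset \<alpha>" using reg by (simp add: regular_point_def)
  then have GR: "Gmap A b R = (0, 0, R)" and R: "R \<in> Omega2 \<alpha>"
    by (simp_all add: Gmap_def Kset_def)
  have Rl: "(norm (u v* R))\<^sup>2 \<le> \<alpha> * (norm u)\<^sup>2" for u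
    using R Omega2_iff_left[OF \<alpha>] by blast
  obtain u v \<sigma> where svd: "is_svd R u v \<sigma>"
    and onto: "gmap A R ` Gamma_space \<alpha> u v \<sigma> = UNIV"
    using reg by (auto simp: regular_point_def)
  define d where "d = outer h x"
  define w0 where "w0 = (1 / \<alpha>) *\<^sub>R outer h (h v* R)"
  have "gmap A R w0 + (- A (Symm (outer h h)), 0) \<in> gmap A R ` Gamma_space \<alpha> u v \<sigma>"
    using onto by simp
  then obtain H where H: "H \<in> Gamma_space \<alpha> u v \<sigma>"
    and gH: "gmap A R H = gmap A R w0 + (- A (Symm (outer h h)), 0)" by auto
  define w where "w = H - w0"
  have gw: "gmap A R w = (- A (Symm (outer h h)), 0)"
    using linear_diff[OF linear_gmap[OF A, of R], of H w0] by (simp add: w_def gH)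
  have xx: "x \<bullet> x = 1" using x by (simp add: norm_eq_1)
  have dd: "d ** transpose d = outer h h"
    by (simp add: d_def outer_mult transpose_outer vec_mult_outer xx)
  have Rd: "R ** transpose d = 0" by (simp add: d_def transpose_outer mult_outer x)
  then have dR: "d ** transpose R = 0"
  proof -
    have "transpose (R ** transpose d) = 0" by (simp only: Rd) (simp add: transpose_def vec_eq_iff)
    then show ?thesis by (simp add: matrix_transpose_mul)
  qed
  have "Symm 0 = (0 :: 'n symm)" by (simp add: zero_symm_def)
  then have "A (Symm 0) = 0" using linear_0[OF A] by simp
  then have Gd: "Gmap' A R d = (0, 0, d)"
    using h by (simp add: Gmap'_def gmap_def Rd dR) (simp add: d_def vec_mult_outer)
  have Gw: "Gmap' A R w + Gmap'' A d = (0, 0, w)"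
    by (simp add: Gmap'_def Gmap''_def gw dd plus_prod_def)
  have tan: "Gmap' A R d \<in> tangent_cone (Kset \<alpha>) (Gmap A b R)"
    unfolding Gd GR
  proof (rule tangent_cone_Kset[OF \<alpha>])
    show "0 \<le> (norm h)\<^sup>2" by simp
    fix t :: real and y
    have "(y v* R) \<bullet> x = 0" by (simp add: dot_lmul_matrix x)
    then have "(norm (y v* (R + t *\<^sub>R d)))\<^sup>2 = (norm (y v* R))\<^sup>2 + t\<^sup>2 * (h \<bullet> y)\<^sup>2"
      using x by (simp add: d_def vector_matrix_mult_add_rdistrib vector_scaleR_matrix_ac vec_mult_outer
          norm_add_sq power_mult_distrib)
    moreover have "(h \<bullet> y)\<^sup>2 \<le> (norm h)\<^sup>2 * (norm y)\<^sup>2"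
      by (metis Cauchy_Schwarz_ineq power2_norm_eq_inner)
    then have "t\<^sup>2 * (h \<bullet> y)\<^sup>2 \<le> t\<^sup>2 * ((norm h)\<^sup>2 * (norm y)\<^sup>2)" by (intro mult_left_mono) auto
    ultimately show "(norm (y v* (R + t *\<^sub>R d)))\<^sup>2 \<le> (\<alpha> + (norm h)\<^sup>2 * t\<^sup>2) * (norm y)\<^sup>2"
      using Rl[of y] by (simp add: algebra_simps)
  qed
  obtain c0 where c0: "0 \<le> c0" "\<And>s y. 2 * s * ((y v* R) \<bullet> (y v* H)) \<le>
      (\<alpha> * (norm y)\<^sup>2 - (norm (y v* R))\<^sup>2) / 2 + c0 * s\<^sup>2 * (norm y)\<^sup>2"
    using Gamma_space_estimate[OF \<alpha> R svd H] by blast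
  obtain c where c: "0 \<le> c" "\<And>t y. 0 < t \<Longrightarrow> t \<le> 1 \<Longrightarrow>
      (norm (y v* (R + t *\<^sub>R d + (t\<^sup>2 / 2) *\<^sub>R w)))\<^sup>2 \<le> (\<alpha> + c * t^3) * (norm y)\<^sup>2"
    using second_order_curve[OF \<alpha> R x c0, of h] unfolding d_def w_def w0_def by blast
  have tan2: "Gmap' A R w + Gmap'' A d \<in> inner_tangent2 (Kset \<alpha>) (Gmap A b R) (Gmap' A R d)"
    unfolding Gd Gw GR by (rule inner_tangent2_Kset[OF \<alpha> c])
  have CRd: "(mat_of C ** R) \<bullet> d = 0"
    by (simp add: d_def inner_commute[of _ "outer h x"] inner_outer x flip: matrix_vector_mul_assoc)
  have second: "0 \<le> (mat_of C ** R) \<bullet> w + (mat_of C ** d) \<bullet> d"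
    using sos tan tan2 CRd unfolding second_order_stationary_def by blast
  \<comment> \<open>\<open>Gamma_space\<close> is a linear space of tangent directions, so \<open>- H\<close> is tangent too\<close>
  have "\<Theta> \<bullet> (- H) \<le> 0"
  proof -
    obtain e where e: "0 \<le> e" "\<And>y. norm (y v* H) \<le> e * norm y"
      using norm_matvec_bound[of H] by metis
    show ?thesis
    proof (rule normal_cone_Omega2_second_order_curve[OF \<alpha> \<Theta>])
      show "0 \<le> c0 + e\<^sup>2" using c0 by simp
      fix t :: real and y
      have "(norm (y v* (R + t *\<^sub>R (- H))))\<^sup>2
          = (norm (y v* R))\<^sup>2 + 2 * (- t) * ((y v* R) \<bullet> (y v* H)) + t\<^sup>2 * (norm (y v* H))\<^sup>2"
        using norm_add_sq[of "y v* R" "- (t *\<^sub>R (y v* H))"]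
        by (simp add: vector_matrix_mult_diff_rdistrib vector_scaleR_matrix_ac power_mult_distrib)
      moreover have "t\<^sup>2 * (norm (y v* H))\<^sup>2 \<le> t\<^sup>2 * (e\<^sup>2 * (norm y)\<^sup>2)"
        by (intro mult_left_mono sq_le_of_bound e) simp
      moreover have "(\<alpha> + (c0 + e\<^sup>2) * t\<^sup>2) * (norm y)\<^sup>2
          = \<alpha> * (norm y)\<^sup>2 + c0 * (- t)\<^sup>2 * (norm y)\<^sup>2 + t\<^sup>2 * (e\<^sup>2 * (norm y)\<^sup>2)"
        by (simp add: algebra_simps)
      ultimately show "(norm (y v* (R + t *\<^sub>R (- H))))\<^sup>2 \<le> (\<alpha> + (c0 + e\<^sup>2) * t\<^sup>2) * (norm y)\<^sup>2"
        using c0(2)[of "- t" y] Rl[of y] by argo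
    qed
  qed
  then have \<Theta>H: "0 \<le> \<Theta> \<bullet> H" by simp
  have quad: "(M ** d) \<bullet> d = h \<bullet> (M *v h)" for M :: "real^'n^'n"
    by (simp add: d_def mult_outer inner_outer outer_mult_vec xx inner_commute)
  have "(mat_of C ** R) \<bullet> w = (mat_of (adjoint A y) ** R + outer ones z) \<bullet> w - \<Theta> \<bullet> w"
  proof -
    have "mat_of C ** R = (mat_of (adjoint A y) ** R + outer ones z) - \<Theta>"
      using kkt by (simp add: minus_symm.rep_eq matrix_diff_rdistrib algebra_simps)
    then show ?thesis by (simp add: inner_diff_left)
  qed
  also have "(mat_of (adjoint A y) ** R + outer ones z) \<bullet> w = gmap A R w \<bullet> (y, z)"
    using adjoint_works[OF linear_gmap[OF A, of R], of w "(y, z)"]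
    by (simp add: adjoint_gmap[OF A] inner_commute)
  also have "\<dots> = - (Symm (d ** transpose d) \<bullet> adjoint A y)"
    by (simp add: gw dd adjoint_works[OF A])
  also have "\<dots> = - (h \<bullet> (mat_of (adjoint A y) *v h))"
    using inner_Symm_gram[of "adjoint A y" d] quad[of "mat_of (adjoint A y)"]
    by (simp add: inner_commute)
  also have "\<Theta> \<bullet> w = \<Theta> \<bullet> H - h \<bullet> ((\<Theta> ** transpose R) *v h) / \<alpha>"
    by (simp add: w_def w0_def inner_diff_right inner_commute[of _ "outer h _"] inner_outer
        flip: matrix_vector_mul_assoc)
  finally show ?thesis
    using second \<Theta>H quad[of "mat_of C"]
    by (simp add: minus_symm.rep_eq matrix_vector_mult_diff_rdistrib inner_diff_right)
qed

section \<open>Almost no cost matrix admits a multiplier of large corank\<close>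

lemma negligible_image_of_lowdim_subspace:
  fixes f :: "'M::euclidean_space \<Rightarrow> 'N::euclidean_space"
  assumes S: "subspace S" and dim: "dim S < DIM('N)" and f: "f differentiable_on S"
  shows "negligible (f ` S)"
proof -
  obtain T :: "'N set" where T: "subspace T" "dim T = dim S"
    using choose_subspace_of_subspace[of "dim S" "UNIV :: 'N set"] dim by auto
  obtain g :: "'N \<Rightarrow> 'M" where g: "linear g" "g ` T = S"
    using isometries_subspaces[OF T(1) S T(2)] by metis
  have diff: "f \<circ> g differentiable_on T"
    unfolding o_def using f g(2) linear_imp_differentiable_on[OF g(1), of T]
    by (simp add: differentiable_on_compose)
  have "negligible T" using T(2) dim by (simp add: negligible_lowdim)
  from negligible_differentiable_image_negligible[OF order_refl this diff]
  have "negligible ((f \<circ> g) ` T)" .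
  then show ?thesis using g(2) by (metis image_comp)
qed

text \<open>
  The unordered pairs from \<open>J\<close> give \<open>card J * (card J + 1) / 2\<close> independent equations; having more
  of them than the \<open>CARD('k)\<close> extra parameters is what makes the bad set below negligible.
\<close>

lemma dim_symm_vanishing_block:
  fixes J :: "'n::finite set"
  defines "V \<equiv> {(T :: 'n symm, y :: real^'k). \<forall>i\<in>J. \<forall>j\<in>J. mat_of T $ i $ j = 0}"
  assumes big: "CARD('k) < (card J * (card J + 1)) div 2"
  shows "subspace V" "dim V < DIM('n symm)"
proof -
  show V: "subspace V"
    by (auto simp: V_def subspace_def zero_symm.rep_eq plus_symm.rep_eq scaleR_symm.rep_eq zero_prod_def)
  define q where "q = card J"
  obtain f where f: "bij_betw f {..<q} J"
    using ex_bij_betw_nat_finite[OF finite[of J]] by (auto simp: q_def atLeast0LessThan)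
  define P where "P = (SIGMA b:{..<q}. {..b})"
  define unit where "unit = (\<lambda>(b, a). (symm_unit (f a) (f b), 0 :: real^'k))"
  have fP: "a < q" "b < q" if "(b, a) \<in> P" for a b using that by (auto simp: P_def)
  have inj: "inj_on unit P"
  proof (rule inj_onI, clarify)
    fix a b c e assume P: "(b, a) \<in> P" "(e, c) \<in> P" and eq: "unit (b, a) = unit (e, c)"
    from eq have "mat_of (symm_unit (f a) (f b)) $ f a $ f b = mat_of (symm_unit (f c) (f e)) $ f a $ f b"
      by (simp add: unit_def)
    then have "(f a = f c \<and> f b = f e) \<or> (f a = f e \<and> f b = f c)"
      by (auto simp: mat_of_symm_unit axis_def split: if_splits)
    moreover have "f x = f y \<longleftrightarrow> x = y" if "x < q" "y < q" for x y
      using f that by (auto simp: bij_betw_def inj_on_def)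
    ultimately have "(a = c \<and> b = e) \<or> (a = e \<and> b = c)"
      using fP[OF P(1)] fP[OF P(2)] by simp
    then show "b = e \<and> a = c" using P by (auto simp: P_def)
  qed
  have "card (unit ` P) = card P" by (rule card_image[OF inj])
  also have "\<dots> = (\<Sum>b<q. Suc b)" by (simp add: P_def)
  also have "\<dots> = (q * (q + 1)) div 2" by (induction q) auto
  finally have card: "card (unit ` P) = (q * (q + 1)) div 2" .
  have "independent (unit ` P)"
  proof (rule pairwise_orthogonal_independent)
    show "0 \<notin> unit ` P" by (auto simp: unit_def zero_prod_def symm_unit_nonzero)
    show "pairwise orthogonal (unit ` P)"
      by (auto simp: pairwise_def orthogonal_def unit_def intro!: symm_unit_orthogonal)
  qed
  then have dimU: "dim (span (unit ` P)) = (q * (q + 1)) div 2"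
    by (simp add: dim_eq_card_independent card)
  have "unit (b, a) \<in> {w. \<forall>x\<in>V. orthogonal x w}" if "(b, a) \<in> P" for a b
  proof -
    have "f a \<in> J" "f b \<in> J" using f fP[OF that] by (auto simp: bij_betw_def)
    then show ?thesis by (auto simp: V_def unit_def orthogonal_def inner_symm_unit)
  qed
  then have "span (unit ` P) \<subseteq> {w \<in> UNIV. \<forall>x\<in>V. orthogonal x w}"
    using subspace_orthogonal_to_vectors[of V] by (intro span_minimal) auto
  then have "dim (span (unit ` P)) \<le> dim {w \<in> UNIV. \<forall>x\<in>V. orthogonal x w}" by (rule dim_subset)
  moreover have "dim {w \<in> UNIV. \<forall>x\<in>V. orthogonal x w} + dim V = DIM('n symm) + CARD('k)"
    using dim_subspace_orthogonal_to_vectors[OF V subspace_UNIV] by simp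
  ultimately show "dim V < DIM('n symm)" using dimU big by (simp add: q_def)
qed

text \<open>
  Exchange a basis of \<open>W\<close> with coordinate vectors to get a coordinate subspace complementary to \<open>W\<close>;
  \<open>J\<close> indexes the remaining coordinates.
\<close>

lemma exists_graph_coordinates:
  fixes W :: "(real^'n) set"
  assumes W: "subspace W"
  obtains J where "card J = dim W"
    "\<And>j. j \<in> J \<Longrightarrow> \<exists>w\<in>W. \<forall>i\<in>J. w $ i = (if i = j then 1 else 0)"
proof -
  obtain B where B: "B \<subseteq> W" "independent B" "W \<subseteq> span B" "card B = dim W"
    using basis_exists by blast
  obtain D where D: "B \<subseteq> D" "D \<subseteq> B \<union> Basis" "independent D" "B \<union> Basis \<subseteq> span D"
    using maximal_independent_subset_extend[of B "B \<union> Basis"] B(2) by auto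
  have fin: "finite D" "finite B" using D(3) B(2) independent_imp_finite by auto
  have "(Basis :: (real^'n) set) \<subseteq> span D" using D(4) by simp
  then have spanD: "span D = UNIV" using span_Basis span_minimal subspace_span by (metis top.extremum_uniqueI)
  then have cardD: "card D = CARD('n)" using dim_eq_card_independent[OF D(3)] dim_span[of D] by simp
  define J where "J = {j. axis j 1 \<notin> D - B}"
  have DB: "D - B = (\<lambda>i. axis i 1) ` (- J)"
  proof
    show "D - B \<subseteq> (\<lambda>i. axis i 1) ` (- J)"
    proof
      fix e assume e: "e \<in> D - B"
      then have "e \<in> Basis" using D(2) by auto
      then obtain i where "e = axis i 1" by (auto simp: Basis_vec_def)
      with e show "e \<in> (\<lambda>i. axis i 1) ` (- J)" by (auto simp: J_def)
    qed
  qed (auto simp: J_def)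
  have "card (- J) = card (D - B)"
    unfolding DB by (rule card_image[symmetric]) (auto simp: inj_on_def axis_eq_axis)
  also have "\<dots> = CARD('n) - dim W" using card_Diff_subset[OF fin(2) D(1)] cardD B(4) by simp
  finally have "card (- J) = CARD('n) - dim W" .
  moreover have "card J + card (- J) = CARD('n)"
    by (metis Compl_partition card_Un_disjoint finite Compl_disjoint)
  moreover have "dim W \<le> CARD('n)" using dim_subset_UNIV[of W] by simp
  ultimately have "card J = dim W" by linarith
  moreover have "\<exists>w\<in>W. \<forall>i\<in>J. w $ i = (if i = j then 1 else 0)" if "j \<in> J" for j
  proof -
    have "axis j 1 \<in> span (B \<union> (D - B))" using spanD D(1) by (simp add: Un_absorb1)
    then obtain w x where w: "w \<in> span B" and x: "x \<in> span (D - B)" and eq: "axis j 1 = w + x"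
      unfolding span_Un by blast
    have "x \<in> {x. \<forall>i\<in>J. x $ i = 0}"
    proof (rule subsetD[OF span_minimal x])
      show "D - B \<subseteq> {x. \<forall>i\<in>J. x $ i = 0}" unfolding DB by (auto simp: axis_def)
      show "subspace {x :: real^'n. \<forall>i\<in>J. x $ i = 0}" by (auto simp: subspace_def)
    qed
    moreover have "w = axis j 1 - x" using eq by simp
    ultimately have "\<forall>i\<in>J. w $ i = (if i = j then 1 else 0)" by (auto simp: axis_def)
    moreover have "w \<in> W" using w B(1) W span_minimal by blast
    ultimately show ?thesis by blast
  qed
  ultimately show ?thesis using that by blast
qed

lemma linear_mat_of_entry: "linear (\<lambda>T :: 'n::finite symm. mat_of T $ i $ j)"
  by (rule linearI) (simp_all add: plus_symm.rep_eq scaleR_symm.rep_eq)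

lemma symm_expansion:
  "X = (\<Sum>i\<in>UNIV. \<Sum>k\<in>UNIV. (mat_of X $ i $ k / 2) *\<^sub>R symm_unit i k)" (is "X = ?S")
proof -
  have "mat_of ?S $ a $ b = mat_of X $ a $ b" for a b
  proof -
    have "mat_of ?S $ a $ b = (\<Sum>i\<in>UNIV. \<Sum>k\<in>UNIV. mat_of X $ i $ k / 2 * mat_of (symm_unit i k) $ a $ b)"
      unfolding linear_sum[OF linear_mat_of_entry] linear_scale[OF linear_mat_of_entry] by simp
    also have "\<dots> = (\<Sum>i\<in>UNIV. \<Sum>k\<in>UNIV. (if i = a then if k = b then mat_of X $ i $ k / 2 else 0 else 0))
        + (\<Sum>i\<in>UNIV. \<Sum>k\<in>UNIV. (if i = b then if k = a then mat_of X $ i $ k / 2 else 0 else 0))"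
      unfolding sum.distrib[symmetric] by (intro sum.cong refl) (simp add: mat_of_symm_unit axis_def)
    also have "\<dots> = mat_of X $ a $ b"
    proof -
      have "(\<Sum>i\<in>UNIV. \<Sum>k\<in>UNIV. (if i = a then if k = b then mat_of X $ i $ k / 2 else 0 else 0))
          = mat_of X $ a $ b / 2" for a b
      proof -
        have "(\<Sum>k\<in>UNIV. (if i = a then if k = b then mat_of X $ i $ k / 2 else 0 else 0))
          = (if i = a then mat_of X $ i $ b / 2 else 0)" for i by simp
        then show ?thesis by simp
      qed
      from this[of a b] this[of b a] show ?thesis by (simp add: mat_of_symmetric[of X b a])
    qed
    finally show ?thesis .
  qed
  then have "mat_of ?S = mat_of X" by (simp add: vec_eq_iff)
  then show ?thesis by (simp add: mat_of_inject)
qed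

text \<open>
  The following charts parametrise the symmetric matrices \<open>M\<close> for which each vector of a subspace
  \<open>W\<close> of the complement of \<open>ones\<close> is sent to a multiple of \<open>ones\<close>. Let \<open>w j\<close>, for \<open>j \<in> J\<close>, be
  vectors of \<open>W\<close> that restrict to the unit vectors on \<open>J\<close>, with \<open>M *v w j = z j *\<^sub>R ones\<close>. Put
  \<open>v k = w k\<close> for \<open>k \<in> J\<close>, and \<open>v k = 0\<close>, \<open>z k = 0\<close> for \<open>k \<notin> J\<close>. Then \<open>a k = axis k 1 - v k\<close>
  vanishes on \<open>J\<close>, its entries add up to 1, and
  \<open>M $ i $ k = z i + z k + a i \<bullet> (M *v a k)\<close>: the block of \<open>M\<close> outside \<open>J\<close>, together with \<open>a\<close> and
  \<open>z\<close>, determines \<open>M\<close>.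

  All these parameters fit into one symmetric matrix \<open>T\<close> with vanishing \<open>J\<close> block: its block
  outside \<open>J\<close> is that of \<open>M\<close>, and its mixed block holds the \<open>a j\<close>, except that the row of a chosen
  index \<open>i\<^sub>0 \<notin> J\<close> holds the \<open>z j\<close>, as the entry of \<open>a j\<close> at \<open>i\<^sub>0\<close> follows from the others.
  The functions \<open>graph_vec T\<close> and \<open>ones_multiple T\<close> read \<open>a\<close> and \<open>z\<close> off \<open>T\<close>.
\<close>

context
  fixes J :: "'n::finite set" and i\<^sub>0 :: 'n
begin

definition graph_vec :: "'n symm \<Rightarrow> 'n \<Rightarrow> 'n \<Rightarrow> real" where
  "graph_vec T k l = (if k \<notin> J then (if l = k then 1 else 0) else
     if l = i\<^sub>0 then 1 - (\<Sum>m\<in>- J - {i\<^sub>0}. mat_of T $ m $ k) else mat_of T $ l $ k)"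

definition ones_multiple :: "'n symm \<Rightarrow> 'n \<Rightarrow> real" where
  "ones_multiple T k = (if k \<in> J then mat_of T $ i\<^sub>0 $ k else 0)"

definition chart :: "'n symm \<Rightarrow> 'n symm" where
  "chart T = (\<Sum>i\<in>UNIV. \<Sum>k\<in>UNIV. ((ones_multiple T i + ones_multiple T k
     + (\<Sum>l\<in>- J. \<Sum>m\<in>- J. graph_vec T i l * mat_of T $ l $ m * graph_vec T k m)) / 2) *\<^sub>R symm_unit i k)"

lemma chart_differentiable:
  fixes L :: "real^'k \<Rightarrow> 'n symm"
  assumes L: "linear L"
  shows "(\<lambda>p. chart (fst p) + L (snd p)) differentiable (at x within S)"
proof -
  have e: "(\<lambda>p. mat_of (fst p) $ i $ j) differentiable (at x within S)" for i j
    by (rule linear_imp_differentiable) (use linear_compose[OF linear_fst linear_mat_of_entry[of i j]] in \<open>simp add: o_def\<close>)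
  have a: "(\<lambda>p. graph_vec (fst p) k l) differentiable (at x within S)" for k l
    unfolding graph_vec_def
    by (cases "k \<in> J"; cases "l = i\<^sub>0")
      (simp_all add: e differentiable_diff differentiable_sum)
  have z: "(\<lambda>p. ones_multiple (fst p) k) differentiable (at x within S)" for k
    unfolding ones_multiple_def by (cases "k \<in> J") (simp_all add: e)
  have "(\<lambda>p. L (snd p)) differentiable (at x within S)"
    by (rule linear_imp_differentiable) (use linear_compose[OF linear_snd L] in \<open>simp add: o_def\<close>)
  then show ?thesis
    unfolding chart_def divide_inverse by (intro differentiable_add differentiable_sum differentiable_scaleR differentiable_mult
        differentiable_const e a z ballI finite)
qed

lemma chart_covers:
  fixes M :: "'n symm"
  assumes i0: "i\<^sub>0 \<notin> J"
    and w: "\<And>j i. j \<in> J \<Longrightarrow> i \<in> J \<Longrightarrow> w j $ i = (if i = j then 1 else 0)"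
    and w1: "\<And>j. j \<in> J \<Longrightarrow> w j \<bullet> ones = 0"
    and Mw: "\<And>j. j \<in> J \<Longrightarrow> mat_of M *v w j = c j *\<^sub>R ones"
  obtains T where "M = chart T" "\<forall>i\<in>J. \<forall>j\<in>J. mat_of T $ i $ j = 0"
proof -
  define v where "v k = (if k \<in> J then w k else 0)" for k
  define z where "z k = (if k \<in> J then c k else 0)" for k
  define a where "a k = axis k 1 - v k" for k
  have Mv: "mat_of M *v v k = z k *\<^sub>R ones" for k by (simp add: v_def z_def Mw)
  have aJ: "a k $ l = 0" if "l \<in> J" for k l using that w by (auto simp: a_def v_def axis_def)
  have a1: "ones \<bullet> a k = 1" for k
    by (simp add: a_def v_def inner_diff_right inner_axis) (simp add: w1 inner_commute)
  have sum_a: "(\<Sum>l\<in>- J. a k $ l) = 1" for k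
  proof -
    have "(\<Sum>l\<in>- J. a k $ l) = (\<Sum>l\<in>UNIV. a k $ l)"
      by (rule sum.mono_neutral_left) (auto simp: aJ)
    then show ?thesis using a1[of k] by (simp add: inner_vec_def)
  qed
  define X where "X = (\<chi> i j. if i \<in> J then (if j \<in> J then 0 else if j = i\<^sub>0 then z i else a i $ j)
     else if j \<in> J then (if i = i\<^sub>0 then z j else a j $ i) else mat_of M $ i $ j)"
  have "transpose X = X" by (auto simp: X_def transpose_def vec_eq_iff mat_of_symmetric)
  then have T: "mat_of (Symm X) = X" by (simp add: Symm_inverse)
  have ca: "graph_vec (Symm X) k l = a k $ l" if l: "l \<notin> J" for k l
  proof -
    have "(\<Sum>m\<in>- J. a k $ m) = a k $ i\<^sub>0 + (\<Sum>m\<in>- J - {i\<^sub>0}. a k $ m)"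
      using i0 by (intro sum.remove) auto
    moreover have "(\<Sum>m\<in>- J - {i\<^sub>0}. X $ m $ k) = (\<Sum>m\<in>- J - {i\<^sub>0}. a k $ m)" if "k \<in> J"
      using that by (intro sum.cong) (auto simp: X_def)
    ultimately show ?thesis
      using l sum_a[of k] by (auto simp: graph_vec_def T) (auto simp: X_def a_def v_def axis_def)
  qed
  have cz: "ones_multiple (Symm X) k = z k" for k using i0 by (simp add: ones_multiple_def T) (simp add: X_def z_def)
  have "mat_of M $ i $ k = ones_multiple (Symm X) i + ones_multiple (Symm X) k
      + (\<Sum>l\<in>- J. \<Sum>m\<in>- J. graph_vec (Symm X) i l * mat_of (Symm X) $ l $ m * graph_vec (Symm X) k m)" for i k
  proof -
    have ax: "axis k 1 = v k + a k" for k by (simp add: a_def)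
    have "mat_of M $ i $ k = axis i 1 \<bullet> (mat_of M *v axis k 1)"
      by (simp add: inner_axis' matrix_vector_mult_basis column_def)
    also have "\<dots> = axis i 1 \<bullet> (z k *\<^sub>R ones) + axis i 1 \<bullet> (mat_of M *v a k)"
      by (simp add: ax[of k] matrix_vector_right_distrib Mv inner_add_right)
    also have "axis i 1 \<bullet> (z k *\<^sub>R ones) = z k" by (simp add: inner_axis')
    also have "axis i 1 \<bullet> (mat_of M *v a k) = (mat_of M *v v i) \<bullet> a k + a i \<bullet> (mat_of M *v a k)"
      using dot_lmul_matrix[of "v i" "mat_of M" "a k"]
      by (simp add: ax[of i] inner_add_left mat_of_vec_commute)
    also have "(mat_of M *v v i) \<bullet> a k = z i" by (simp add: Mv a1)
    also have "a i \<bullet> (mat_of M *v a k) = (\<Sum>l\<in>UNIV. \<Sum>m\<in>UNIV. a i $ l * mat_of M $ l $ m * a k $ m)"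
      by (simp add: inner_vec_def matrix_vector_mult_def sum_distrib_left ac_simps)
    also have "\<dots> = (\<Sum>l\<in>- J. \<Sum>m\<in>UNIV. a i $ l * mat_of M $ l $ m * a k $ m)"
      by (rule sum.mono_neutral_right) (auto simp: aJ)
    also have "\<dots> = (\<Sum>l\<in>- J. \<Sum>m\<in>- J. a i $ l * mat_of M $ l $ m * a k $ m)"
      by (intro sum.cong refl sum.mono_neutral_right) (auto simp: aJ)
    also have "\<dots> = (\<Sum>l\<in>- J. \<Sum>m\<in>- J. graph_vec (Symm X) i l * mat_of (Symm X) $ l $ m * graph_vec (Symm X) k m)"
      by (intro sum.cong refl) (simp add: ca T, simp add: X_def)
    finally show ?thesis by (simp add: cz)
  qed
  then have "M = chart (Symm X)"
    unfolding chart_def by (subst symm_expansion) simp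
  moreover have "\<forall>i\<in>J. \<forall>j\<in>J. mat_of (Symm X) $ i $ j = 0" unfolding T by (simp add: X_def)
  ultimately show ?thesis by (rule that)
qed

end

text \<open>
  Each chart is a polynomial map on a subspace of dimension less than that of the space of symmetric
  matrices, and finitely many charts cover the set.
\<close>

lemma negligible_large_corank:
  fixes L :: "real^'k \<Rightarrow> 'n::finite symm"
  assumes L: "linear L" and q: "CARD('k) < (q * (q + 1)) div 2"
  shows "negligible {C. \<exists>y W. subspace W \<and> dim W = q \<and>
    (\<forall>w\<in>W. w \<bullet> ones = 0 \<and> (\<exists>c. mat_of (C - L y) *v w = c *\<^sub>R ones))}" (is "negligible ?bad")
proof -
  let ?V = "\<lambda>J :: 'n set. {(T :: 'n symm, y :: real^'k). \<forall>i\<in>J. \<forall>j\<in>J. mat_of T $ i $ j = 0}"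
  let ?f = "\<lambda>J i\<^sub>0 p. chart J i\<^sub>0 (fst p) + L (snd p)"
  have "negligible (\<Union>(J, i\<^sub>0) \<in> {J. card J = q} \<times> UNIV. ?f J i\<^sub>0 ` ?V J)"
  proof (intro negligible_Union finite_imageI)
    fix N assume "N \<in> (\<lambda>(J, i\<^sub>0). ?f J i\<^sub>0 ` ?V J) ` ({J. card J = q} \<times> UNIV)"
    then obtain J i\<^sub>0 where J: "card J = q" and N: "N = ?f J i\<^sub>0 ` ?V J" by auto
    show "negligible N"
      unfolding N
    proof (rule negligible_image_of_lowdim_subspace)
      show "subspace (?V J)" "dim (?V J) < DIM('n symm)"
        using dim_symm_vanishing_block[of J] q J by simp_all
      show "?f J i\<^sub>0 differentiable_on ?V J"
        using chart_differentiable[OF L] by (simp add: differentiable_on_def)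
    qed
  qed simp
  moreover have "?bad \<subseteq> (\<Union>(J, i\<^sub>0) \<in> {J. card J = q} \<times> UNIV. ?f J i\<^sub>0 ` ?V J)"
  proof
    fix C assume "C \<in> ?bad"
    then obtain y W where W: "subspace W" "dim W = q" and W1: "\<And>w. w \<in> W \<Longrightarrow> w \<bullet> ones = 0"
      and CW: "\<And>w. w \<in> W \<Longrightarrow> \<exists>c. mat_of (C - L y) *v w = c *\<^sub>R ones" by blast
    obtain J where J: "card J = q"
      and ex: "\<And>j. j \<in> J \<Longrightarrow> \<exists>w\<in>W. \<forall>i\<in>J. w $ i = (if i = j then 1 else 0)"
      using exists_graph_coordinates[OF W(1)] W(2) by metis
    obtain w where w: "\<And>j. j \<in> J \<Longrightarrow> w j \<in> W"
        "\<And>j i. j \<in> J \<Longrightarrow> i \<in> J \<Longrightarrow> w j $ i = (if i = j then 1 else 0)"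
      using ex by metis
    have "\<forall>j\<in>J. \<exists>c. mat_of (C - L y) *v w j = c *\<^sub>R ones" using CW w(1) by blast
    from bchoice[OF this]
    obtain c where c: "\<And>j. j \<in> J \<Longrightarrow> mat_of (C - L y) *v w j = c j *\<^sub>R ones" by blast
    have "J \<noteq> UNIV"
    proof
      assume "J = UNIV"
      then have "w j = axis j 1" for j using w(2) by (simp add: vec_eq_iff axis_def)
      then have "(axis j 1 :: real^'n) \<bullet> ones = 0" for j using W1[of "w j"] w(1) \<open>J = UNIV\<close> by simp
      then show False by (simp add: inner_axis')
    qed
    then obtain i\<^sub>0 where i0: "i\<^sub>0 \<notin> J" by blast
    obtain T where T: "C - L y = chart J i\<^sub>0 T" "\<forall>i\<in>J. \<forall>j\<in>J. mat_of T $ i $ j = 0"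
      using chart_covers[OF i0 w(2) W1[OF w(1)] c] by metis
    then have "C = ?f J i\<^sub>0 (T, y)" by (simp add: diff_eq_eq)
    moreover have "(T, y) \<in> ?V J" using T(2) by simp
    ultimately show "C \<in> (\<Union>(J, i\<^sub>0) \<in> {J. card J = q} \<times> UNIV. ?f J i\<^sub>0 ` ?V J)"
      using J by blast
  qed
  ultimately show ?thesis by (rule negligible_subset)
qed

section \<open>Generic rank deficiency and the theorem\<close>

lemma Bessel_inequality:
  assumes "finite B" "pairwise orthogonal B" "\<And>b. b \<in> B \<Longrightarrow> norm b = 1"
  shows "(\<Sum>b\<in>B. (x \<bullet> b)\<^sup>2) \<le> (norm (x :: 'a::real_inner))\<^sup>2"
proof -
  let ?p = "\<Sum>b\<in>B. (x \<bullet> b) *\<^sub>R b"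
  have pb: "?p \<bullet> b = x \<bullet> b" if "b \<in> B" for b
  proof -
    have "(x \<bullet> a) * (a \<bullet> b) = (if a = b then x \<bullet> b else 0)" if "a \<in> B" for a
      using assms(2,3) that \<open>b \<in> B\<close> by (auto simp: pairwise_def orthogonal_def norm_eq_1)
    then show ?thesis using that assms(1) by (simp add: inner_sum_left)
  qed
  have "?p \<bullet> ?p = (\<Sum>b\<in>B. (x \<bullet> b)\<^sup>2)" "x \<bullet> ?p = (\<Sum>b\<in>B. (x \<bullet> b)\<^sup>2)"
    by (simp_all add: inner_sum_right pb power2_eq_square)
  moreover have "0 \<le> (x - ?p) \<bullet> (x - ?p)" by simp
  ultimately show ?thesis
    by (simp add: inner_diff_left inner_diff_right inner_commute power2_norm_eq_inner)
qed

text \<open>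
  By Bessel's inequality for the rows of \<open>R\<close>, each unit vector of an orthonormal basis of the top
  singular space contributes \<open>\<alpha>\<close> to the squared Frobenius norm. This limits the multiplicity of
  the singular value \<open>sqrt \<alpha>\<close> by \<open>\<beta> / \<alpha>\<close>.
\<close>

lemma dim_top_singular_space:
  fixes R :: "real^'r^'n" and \<alpha> :: real
  defines "E \<equiv> {x. (R *v x) v* R = \<alpha> *\<^sub>R x}"
  shows "subspace E" "real (dim E) * \<alpha> \<le> R \<bullet> R"
proof -
  show E: "subspace E"
    by (auto simp: E_def subspace_def matrix_vector_right_distrib vector_matrix_left_distrib
        matrix_vector_mult_scaleR scaleR_vector_matrix_assoc scaleR_add_right)
  obtain B where B: "B \<subseteq> E" "pairwise orthogonal B" "\<And>x. x \<in> B \<Longrightarrow> norm x = 1"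
      "independent B" "card B = dim E"
    using orthonormal_basis_subspace[OF E] by metis
  have fin: "finite B" using B(4) by (rule independent_imp_finite)
  have "(norm (R *v x))\<^sup>2 = \<alpha>" if "x \<in> B" for x
  proof -
    have "(norm (R *v x))\<^sup>2 = ((R *v x) v* R) \<bullet> x" by (simp add: dot_lmul_matrix power2_norm_eq_inner)
    also have "\<dots> = \<alpha> * (x \<bullet> x)" using that B(1) by (auto simp: E_def)
    also have "x \<bullet> x = 1" using B(3)[OF that] by (simp add: norm_eq_1)
    finally show ?thesis by simp
  qed
  then have "real (dim E) * \<alpha> = (\<Sum>x\<in>B. (norm (R *v x))\<^sup>2)" using B(5) by simp
  also have "\<dots> = (\<Sum>x\<in>B. \<Sum>i\<in>UNIV. (R $ i \<bullet> x)\<^sup>2)"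
  proof (intro sum.cong refl)
    fix x
    have "(R *v x) $ i = R $ i \<bullet> x" for i by (simp add: matrix_vector_mult_def inner_vec_def)
    moreover have "(norm (R *v x))\<^sup>2 = (\<Sum>i\<in>UNIV. ((R *v x) $ i)\<^sup>2)"
      unfolding power2_norm_eq_inner by (subst inner_vec_def) (simp add: power2_eq_square)
    ultimately show "(norm (R *v x))\<^sup>2 = (\<Sum>i\<in>UNIV. (R $ i \<bullet> x)\<^sup>2)" by simp
  qed
  also have "\<dots> = (\<Sum>i\<in>UNIV. \<Sum>x\<in>B. (R $ i \<bullet> x)\<^sup>2)" by (rule sum.swap)
  also have "\<dots> \<le> (\<Sum>i\<in>UNIV. (norm (R $ i))\<^sup>2)"
    by (intro sum_mono Bessel_inequality fin B)
  also have "\<dots> = R \<bullet> R" by (simp add: inner_vec_def power2_norm_eq_inner)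
  finally show "real (dim E) * \<alpha> \<le> R \<bullet> R" .
qed

lemma feasible_gram_in_sdp:
  assumes "R \<in> sdplr1_feasible A b \<alpha>"
  shows "Symm (R ** transpose R) \<in> sdp_feasible A b"
    and "trace (mat_of (Symm (R ** transpose R))) = R \<bullet> (R :: real^'r^'n)"
  using assms psd_gram[of R]
  by (simp_all add: sdp_feasible_def sdplr1_feasible_def mat_of_Symm_gram flip: matrix_vector_mul_assoc)
    (simp add: trace_def inner_vec_def matrix_matrix_mult_def transpose_def)

text \<open>
  \<open>\<Theta>\<close> kills the orthogonal complement of the top right singular space, so there the stationarity
  equation reads \<open>M *v (R *v x) = (z \<bullet> x) *\<^sub>R ones\<close>; injectivity of \<open>R\<close> makes the image of this
  complement large.
\<close>

lemma injective_stationary_point_large_corank: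
  fixes R \<Theta> :: "real^'r^'n"
  assumes \<alpha>: "0 < \<alpha>" and R1: "ones v* R = 0"
    and \<Theta>: "\<Theta> \<in> normal_cone (Omega2 \<alpha>) R"
    and kkt: "M ** R - outer ones z = - \<Theta>"
    and inj: "\<And>x. R *v x = 0 \<Longrightarrow> x = 0"
  obtains W where "subspace W" "CARD('r) \<le> dim W + dim {x. (R *v x) v* R = \<alpha> *\<^sub>R x}"
    "\<And>w. w \<in> W \<Longrightarrow> w \<bullet> ones = 0 \<and> (\<exists>c. M *v w = c *\<^sub>R ones)"
proof -
  let ?E = "{x. (R *v x) v* R = \<alpha> *\<^sub>R x}"
  let ?F = "{x \<in> UNIV. \<forall>k\<in>?E. orthogonal k x}"
  have E: "subspace ?E" by (rule dim_top_singular_space)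
  have F: "subspace ?F" using subspace_orthogonal_to_vectors[of ?E] by simp
  have dimF: "dim ?F + dim ?E = CARD('r)"
    using dim_subspace_orthogonal_to_vectors[OF E subspace_UNIV] by simp
  have \<Theta>F: "\<Theta> *v x = 0" if "x \<in> ?F" for x
  proof -
    have "g \<bullet> (\<Theta> *v x) = 0" for g
    proof -
      have "\<Theta> ** (transpose R ** R) = \<alpha> *\<^sub>R \<Theta>"
        using normal_cone_Omega2_complementary[OF \<alpha> \<Theta>] by (simp add: matrix_mul_assoc)
      from arg_cong[OF this, of "\<lambda>Z. g v* Z"]
      have "g v* \<Theta> \<in> ?E"
        by (simp add: vector_scaleR_matrix_ac flip: vector_matrix_mul_assoc)
      then have "(g v* \<Theta>) \<bullet> x = 0" using that by (simp add: orthogonal_def)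
      then show ?thesis by (simp add: dot_lmul_matrix)
    qed
    then show ?thesis using inner_eq_zero_iff by blast
  qed
  let ?W = "(*v) R ` ?F"
  have lin: "linear ((*v) R)" by simp
  show ?thesis
  proof (rule that)
    show "subspace ?W" by (rule linear_subspace_image[OF lin F])
    have "inj ((*v) R)" using inj linear_injective_0[OF lin] by blast
    then have "dim ?W = dim ?F" by (intro dim_image_eq lin) (rule inj_on_subset, auto)
    then show "CARD('r) \<le> dim ?W + dim ?E" using dimF by simp
    fix w assume "w \<in> ?W"
    then obtain x where x: "x \<in> ?F" "w = R *v x" by blast
    have "w \<bullet> ones = (ones v* R) \<bullet> x" unfolding x(2) dot_lmul_matrix by (rule inner_commute)
    then have w1: "w \<bullet> ones = 0" by (simp add: R1)
    have "M ** R = outer ones z - \<Theta>" using kkt by (simp add: algebra_simps)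
    then have "M *v w = (z \<bullet> x) *\<^sub>R ones"
      using \<Theta>F[OF x(1)]
      by (simp add: x(2) matrix_vector_mul_assoc matrix_vector_mult_diff_rdistrib outer_mult_vec)
    with w1 show "w \<bullet> ones = 0 \<and> (\<exists>c. M *v w = c *\<^sub>R ones)" by blast
  qed
qed

lemma large_codimension:
  fixes q :: nat and m :: nat
  assumes "1 \<le> m" "sqrt (2 * real m) \<le> real q"
  shows "m - 1 < (q * (q + 1)) div 2"
proof -
  have "2 * real m \<le> (real q)\<^sup>2" using assms(2) by (metis real_sqrt_le_iff real_sqrt_abs abs_of_nat)
  then have "2 * m \<le> q * q" by (simp add: power2_eq_square) (metis (mono_tags) of_nat_le_iff of_nat_mult of_nat_numeral)
  then have "2 * m \<le> q * (q + 1)" by simp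
  then have "m \<le> (q * (q + 1)) div 2" by linarith
  with assms(1) show ?thesis by linarith
qed

theorem theorem2p8:
  fixes A :: "'n::finite symm \<Rightarrow> real^'k"
    and b :: "real^'k"
    and \<alpha> \<beta> :: real
    and m :: nat
  assumes "linear A"
    and "m - 1 = CARD('k)"
    and "0 < \<alpha>"
    and "\<beta> \<in> (\<lambda>X. trace (mat_of X)) ` sdp_feasible A b"
    and "\<forall>X\<in>sdp_feasible A b. trace (mat_of X) \<le> \<beta>"
    and "real CARD('r::finite) \<ge> real_of_int \<lceil>\<beta> / \<alpha>\<rceil> + sqrt (2 * real m)"
  shows "AE C in lborel. \<forall>R :: real^'r^'n.
    regular_point A b \<alpha> R \<and> second_order_stationary A b \<alpha> C R \<longrightarrow>
      sdplr1_global_minimizer A b \<alpha> C R \<and>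
      (\<forall>y z \<Theta>. \<Theta> \<in> normal_cone (Omega2 \<alpha>) R \<longrightarrow>
         mat_of (C - adjoint A y) ** R - outer ones z = - \<Theta> \<longrightarrow>
           adjoint (gmap A R) (y, z) = mat_of C ** R + \<Theta> \<and>
           surj (gmap A R) \<and>
           bij (gmap A R \<circ> adjoint (gmap A R)) \<and>
           (y, z) = inv (gmap A R \<circ> adjoint (gmap A R)) (gmap A R (mat_of C ** R + \<Theta>)))"
proof -
  let ?bad = "\<lambda>q. {C. \<exists>y W. subspace W \<and> dim W = q \<and>
    (\<forall>w\<in>W. w \<bullet> ones = 0 \<and> (\<exists>c. mat_of (C - adjoint A y) *v w = c *\<^sub>R ones))}"
  \<comment> \<open>the bound \<open>CARD('n)\<close> on the dimension keeps the union of bad sets finite\<close>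
  define Q where "Q = {q. q \<le> CARD('n) \<and> CARD('k) < (q * (q + 1)) div 2}"
  let ?N = "\<Union>q\<in>Q. ?bad q"
  have "negligible ?N"
    using negligible_large_corank[OF adjoint_linear[OF assms(1)]]
    by (intro negligible_Union finite_imageI) (auto simp: Q_def)
  then have "AE C in lebesgue. C \<notin> ?N"
    unfolding negligible_iff_null_sets by (rule AE_not_in)
  then have "AE C in lborel. C \<notin> ?N" by (simp only: AE_completion_iff)
  then show ?thesis
  proof eventually_elim
    fix C assume C: "C \<notin> ?N"
    show "\<forall>R :: real^'r^'n.
      regular_point A b \<alpha> R \<and> second_order_stationary A b \<alpha> C R \<longrightarrow>
      sdplr1_global_minimizer A b \<alpha> C R \<and>
      (\<forall>y z \<Theta>. \<Theta> \<in> normal_cone (Omega2 \<alpha>) R \<longrightarrow>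
         mat_of (C - adjoint A y) ** R - outer ones z = - \<Theta> \<longrightarrow>
           adjoint (gmap A R) (y, z) = mat_of C ** R + \<Theta> \<and>
           surj (gmap A R) \<and>
           bij (gmap A R \<circ> adjoint (gmap A R)) \<and>
           (y, z) = inv (gmap A R \<circ> adjoint (gmap A R)) (gmap A R (mat_of C ** R + \<Theta>)))"
    proof (intro allI impI conjI, goal_cases)
      case (1 R)
      then have reg: "regular_point A b \<alpha> R" and sos: "second_order_stationary A b \<alpha> C R" by auto
      have R: "R \<in> sdplr1_feasible A b \<alpha>" using reg by (simp add: regular_point_def feasible_iff_Gmap)
      obtain y z \<Theta> where \<Theta>: "\<Theta> \<in> normal_cone (Omega2 \<alpha>) R"
        and kkt: "mat_of (C - adjoint A y) ** R - outer ones z = - \<Theta>"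
        using sos by (auto simp: second_order_stationary_def)
      \<comment> \<open>an injective \<open>R\<close> would put \<open>C\<close> into the negligible set\<close>
      have "\<exists>x. R *v x = 0 \<and> x \<noteq> 0"
      proof (rule ccontr)
        assume "\<not> ?thesis"
        then have inj: "\<And>x. R *v x = 0 \<Longrightarrow> x = 0" by blast
        have ones: "ones v* R = 0" using R by (simp add: sdplr1_feasible_def)
        obtain W where W: "subspace W" "CARD('r) \<le> dim W + dim {x. (R *v x) v* R = \<alpha> *\<^sub>R x}"
          and WC: "\<And>w. w \<in> W \<Longrightarrow> w \<bullet> ones = 0 \<and> (\<exists>c. mat_of (C - adjoint A y) *v w = c *\<^sub>R ones)"
          using injective_stationary_point_large_corank[OF assms(3) ones \<Theta> kkt inj] by blast
        have "real (dim {x. (R *v x) v* R = \<alpha> *\<^sub>R x}) * \<alpha> \<le> \<beta>"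
          using dim_top_singular_space(2)[of R \<alpha>] feasible_gram_in_sdp[OF R] assms(5) by fastforce
        then have "real (dim {x. (R *v x) v* R = \<alpha> *\<^sub>R x}) \<le> \<beta> / \<alpha>"
          using assms(3) by (simp add: pos_le_divide_eq)
        also have "\<dots> \<le> real_of_int \<lceil>\<beta> / \<alpha>\<rceil>" by (rule le_of_int_ceiling)
        finally have "sqrt (2 * real m) \<le> real (dim W)" using W(2) assms(6) by linarith
        moreover have "1 \<le> m" using assms(2) by (cases m) auto
        ultimately have "dim W \<in> Q"
          using large_codimension[of m "dim W"] assms(2) dim_subset_UNIV[of W] by (simp add: Q_def)
        moreover have "C \<in> ?bad (dim W)" using W(1) WC by blast
        ultimately show False using C by blast
      qed
      then obtain x where x: "R *v x = 0" "x \<noteq> 0" by blast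
      let ?x = "(1 / norm x) *\<^sub>R x"
      have x': "R *v ?x = 0" "norm ?x = 1" using x by (simp_all add: matrix_vector_mult_scaleR)
      show ?case
        using curvature_of_second_order[OF assms(1,3) reg sos \<Theta> kkt x']
        by (rule global_minimizer_of_certificate[OF assms(1,3) R \<Theta> kkt])
    next
      case (2 R y z \<Theta>)
      then show ?case
        by (simp add: adjoint_gmap[OF assms(1)] minus_symm.rep_eq matrix_diff_rdistrib algebra_simps)
    next
      case (3 R y z \<Theta>)
      then show ?case by (auto simp: regular_point_def)
    next
      case (4 R y z \<Theta>)
      then show ?case
        by (intro bij_compose_adjoint linear_gmap assms(1)) (auto simp: regular_point_def)
    next
      case (5 R y z \<Theta>)
      have bij: "bij (gmap A R \<circ> adjoint (gmap A R))"
        using 5 by (intro bij_compose_adjoint linear_gmap assms(1)) (auto simp: regular_point_def)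
      have "mat_of C ** R + \<Theta> = adjoint (gmap A R) (y, z)"
        using 5 by (simp add: adjoint_gmap[OF assms(1)] minus_symm.rep_eq matrix_diff_rdistrib algebra_simps)
      then show ?case using inv_f_f[OF bij_is_inj[OF bij], of "(y, z)"] by simp
    qed
  qed
qed

end
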